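(* Let $L_N=L_N[0,1]$ be an Orlicz space such that the Orlicz function $N$ satisfies the $\Delta_2^\infty$-condition, i.e. $\sup_{u\ge1}N(2u)/N(u)<\infty$. Then $\mathcal F(L_N)=[1/\beta_N,\,1/\alpha_N]$, where $$\alpha_N=-\lim_{n\to\infty}\frac1n\log_2\sup_{k\le 0}\frac{N^{-1}(2^{k-n})}{N^{-1}(2^{k})},\qquad \beta_N=\lim_{n\to\infty}\frac1n\log_2\sup_{k\le 0}\frac{N^{-1}(2^{k})}{N^{-1}(2^{k-n})},$$ the suprema being taken over integers $k\le 0$.
   Context: An Orlicz function is a convex continuous increasing function $N$ on $[0,\infty)$ with $N(0)=0$ and $N(\infty)=\infty$; $N^{-1}$ is its inverse function. The Orlicz space $L_N[0,1]$ consists of all measurable $x$ on $[0,1]$ with finite Luxemburg norm $\|x\|_{L_N}=\inf\{u>0:\int_0^1N(|x(t)|/u)\,dt\le1\}$. Let $m$ be Lebesgue measure on $[0,1]$. For measurable $f$ on $[0,1]$, $f^*(t)=\inf\{\tau\ge0:m\{s:|f(s)|>\tau\}\le t\}$. A rearrangement invariant space $X$ on $[0,1]$ is a Banach space of (classes of) a.e. finite real measurable functions on $[0,1]$ such that $f\in X$, $g$ measurable, $g^*\le f^*$ imply $g\in X$ and $\|g\|_X\le\|f\|_X$; Orlicz spaces are of this kind. Functions $x,y$ on $[0,1]$ are equimeasurable if $m\{|x|>\tau\}=m\{|y|>\tau\}$ for all $\tau>0$. For $a\in\mathbb R^n$, $\|a\|_p=(\sum_k|a_k|^p)^{1/p}$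 if $1\le p<\infty$ and $\|a\|_\infty=\max_k|a_k|$. For $1\le p\le\infty$, $\ell^p$ is symmetrically finitely represented in a rearrangement invariant space $X$ on $[0,1]$ if for every $n\in\mathbb N$ and $\varepsilon>0$ there exist equimeasurable functions $x_1,\dots,x_n\in X$ with pairwise disjoint supports such that $(1+\varepsilon)^{-1}\|a\|_p\le\|\sum_{k=1}^na_kx_k\|_X\le(1+\varepsilon)\|a\|_p$ for all $a=(a_k)_{k=1}^n\in\mathbb R^n$. $\mathcal F(X)$ is the set of all $p\in[1,\infty]$ such that $\ell^p$ is symmetrically finitely represented in $X$. Convention: $1/0=\infty$, and intervals are subintervals of $[1,\infty]$.
   Formalization: In the definitions of α_N and β_N the suprema are taken over integers k ≥ n instead of k ≤ 0; with k ≤ 0 the claim is false, e.g. for N(u)=max(u,u²), where it would give F(L_N)={1} although L_N is L_2 up to equivalent norm. *)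

theory Defs
  imports "HOL-Analysis.Analysis"
begin

abbreviation unit_leb :: "real measure" where
  "unit_leb \<equiv> lebesgue_on {0..1}"

text \<open>
  Strict monotonicity is what makes the inverse of an Orlicz function meaningful on
  \<open>[0, \<infinity>)\<close>. Only the values of \<open>N\<close> on \<open>[0, \<infinity>)\<close> matter.
\<close>

definition orlicz_function :: "(real \<Rightarrow> real) \<Rightarrow> bool" where
  "orlicz_function N \<longleftrightarrow>
     convex_on {0..} N \<and> continuous_on {0..} N \<and> strict_mono_on {0..} N \<and>
     N 0 = 0 \<and> filterlim N at_top at_top"

definition orlicz_inv :: "(real \<Rightarrow> real) \<Rightarrow> real \<Rightarrow> real" where
  "orlicz_inv N = the_inv_into {0..} N"

definition Delta2_infinity :: "(real \<Rightarrow> real) \<Rightarrow> bool" where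
  "Delta2_infinity N \<longleftrightarrow> bdd_above ((\<lambda>u. N (2 * u) / N u) ` {1..})"

text \<open>
  The infimum is taken in \<open>[0, \<infinity>]\<close>, so that it is \<open>\<infinity>\<close> when no \<open>u\<close> is admissible.
\<close>

definition luxemburg_norm :: "(real \<Rightarrow> real) \<Rightarrow> (real \<Rightarrow> real) \<Rightarrow> ennreal" where
  "luxemburg_norm N x =
     (INF u \<in> {u. 0 < u \<and> (\<integral>\<^sup>+t. ennreal (N (\<bar>x t\<bar> / u)) \<partial>unit_leb) \<le> 1}. ennreal u)"

text \<open>
  Elements are represented by functions rather than by classes modulo null sets; the values
  of a representative outside \<open>[0, 1]\<close> are irrelevant.
\<close>

definition orlicz_space :: "(real \<Rightarrow> real) \<Rightarrow> (real \<Rightarrow> real) set" where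
  "orlicz_space N = {x \<in> borel_measurable unit_leb. luxemburg_norm N x < \<infinity>}"

definition equimeasurable :: "(real \<Rightarrow> real) \<Rightarrow> (real \<Rightarrow> real) \<Rightarrow> bool" where
  "equimeasurable x y \<longleftrightarrow>
     (\<forall>\<tau>>0. measure unit_leb {t \<in> {0..1}. \<bar>x t\<bar> > \<tau>} = measure unit_leb {t \<in> {0..1}. \<bar>y t\<bar> > \<tau>})"

definition supp :: "(real \<Rightarrow> real) \<Rightarrow> real set" where
  "supp x = {t \<in> {0..1}. x t \<noteq> 0}"

text \<open>
  A vector of \<open>\<real>\<^sup>n\<close> is a function on \<open>nat\<close> of which only the values on \<open>{1..n}\<close> are used.
\<close>

definition ellp_norm :: "ereal \<Rightarrow> nat \<Rightarrow> (nat \<Rightarrow> real) \<Rightarrow> real" where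
  "ellp_norm p n a =
     (if p = \<infinity> then Max ((\<lambda>k. \<bar>a k\<bar>) ` {1..n})
      else (\<Sum>k = 1..n. \<bar>a k\<bar> powr real_of_ereal p) powr (1 / real_of_ereal p))"

text \<open>
  A rearrangement invariant space enters through its set \<open>X\<close> of elements and its norm
  \<open>nrm\<close>, which is \<open>[0, \<infinity>]\<close>-valued and finite on \<open>X\<close>.
\<close>

definition sym_finitely_represented ::
    "ereal \<Rightarrow> (real \<Rightarrow> real) set \<Rightarrow> ((real \<Rightarrow> real) \<Rightarrow> ennreal) \<Rightarrow> bool" where
  "sym_finitely_represented p X nrm \<longleftrightarrow>
     (\<forall>n\<ge>1. \<forall>\<epsilon>>0. \<exists>x :: nat \<Rightarrow> real \<Rightarrow> real.
        (\<forall>k\<in>{1..n}. x k \<in> X) \<and>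
        (\<forall>i\<in>{1..n}. \<forall>j\<in>{1..n}. equimeasurable (x i) (x j)) \<and>
        disjoint_family_on (\<lambda>k. supp (x k)) {1..n} \<and>
        (\<forall>a :: nat \<Rightarrow> real.
           ennreal (ellp_norm p n a / (1 + \<epsilon>)) \<le> nrm (\<lambda>t. \<Sum>k = 1..n. a k * x k t) \<and>
           nrm (\<lambda>t. \<Sum>k = 1..n. a k * x k t) \<le> ennreal ((1 + \<epsilon>) * ellp_norm p n a)))"

definition sym_fin_rep_set ::
    "(real \<Rightarrow> real) set \<Rightarrow> ((real \<Rightarrow> real) \<Rightarrow> ennreal) \<Rightarrow> ereal set" where
  "sym_fin_rep_set X nrm = {p. 1 \<le> p \<and> sym_finitely_represented p X nrm}"

text \<open>
  The indices of \<open>N\<close> at infinity. The integer \<open>k\<close> runs over \<open>k \<ge> n\<close>, that is, both arguments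
  \<open>2\<^sup>k\<close> and \<open>2\<^sup>k\<^sup>-\<^sup>n\<close> of the inverse are at least \<open>1\<close>. This is the range that belongs to \<open>[0, 1]\<close>:
  the fundamental function of the Orlicz space is \<open>t \<mapsto> 1 / N\<^sup>-\<^sup>1 (1 / t)\<close> with \<open>0 < t \<le> 1\<close>,
  and changing \<open>N\<close> near \<open>0\<close> gives the same space up to equivalence of norms.
  With \<open>k \<le> 0\<close>, as the formulas are sometimes printed, one would get the indices of
  \<open>N\<close> at zero, which describe Orlicz sequence spaces and have no bearing on \<open>[0, 1]\<close>.
\<close>

definition orlicz_alpha :: "(real \<Rightarrow> real) \<Rightarrow> real" where
  "orlicz_alpha N =
     - lim (\<lambda>n::nat. 1 / real n *
         log 2 (SUP k \<in> {int n..}. orlicz_inv N (2 powi (k - int n)) / orlicz_inv N (2 powi k)))"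

definition orlicz_beta :: "(real \<Rightarrow> real) \<Rightarrow> real" where
  "orlicz_beta N =
     lim (\<lambda>n::nat. 1 / real n *
         log 2 (SUP k \<in> {int n..}. orlicz_inv N (2 powi k) / orlicz_inv N (2 powi (k - int n))))"

end

theory Submission
  imports Defs
begin

text \<open>
  For disjointly supported copies of one function \<open>x\<close>, the condition that
  \<open>\<parallel>\<Sum> a\<^sub>k x\<^sub>k\<parallel>\<close> be close to \<open>1\<close> says that \<open>\<Sum> F (\<bar>a\<^sub>k\<bar>)\<close> is close to \<open>1\<close>, where
  \<open>F s = \<integral> N (s \<bar>x\<bar>)\<close> is the modular. So \<open>\<ell>\<^sup>p\<close> is represented precisely when \<open>s\<^sup>p\<close> can be
  approximated by such integrals. Having \<open>n\<close> disjoint copies in \<open>[0, 1]\<close> forces the support of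
  \<open>x\<close> to have measure at most \<open>1 / n\<close>; hence bounded values of \<open>x\<close> contribute next to nothing and
  only the behaviour of \<open>N\<close> at infinity counts. That behaviour enters through the properties
  \<open>grows_at_least q\<close> and \<open>grows_at_most q\<close>, which compare \<open>N (R w)\<close> with \<open>R\<^sup>q N w\<close> for large \<open>w\<close>
  and all \<open>R \<ge> 1\<close>. Up to the endpoint they say \<open>\<beta>\<^sub>N \<le> 1 / q\<close> and \<open>1 / q \<le> \<alpha>\<^sub>N\<close>.

  The interval is necessary because a function that grows at least (at most) like the \<open>q\<close>-th
  power gives an \<open>F\<close> that does the same, up to an error of order \<open>1 / n\<close>. Testing the
  representation on sums of \<open>m\<close> of the \<open>n\<close> copies, with \<open>n \<rightarrow> \<infinity>\<close> first and \<open>m \<rightarrow> \<infinity>\<close> afterwards,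
  compares \<open>m\<close> with a multiple of \<open>m\<^bsup>q/p\<^esup>\<close> and so places \<open>p\<close> on the correct side of \<open>q\<close>
  (\<open>inverse_le_beta_if_represented\<close>, \<open>alpha_le_inverse_if_represented\<close>). The \<open>\<Delta>\<^sub>2\<close>-condition makes
  \<open>\<alpha>\<^sub>N\<close> positive, which excludes \<open>p = \<infinity>\<close>.

  The interval is sufficient because of a dichotomy. Fix \<open>D > 1\<close> and put
  \<open>H k = N (D\<^sup>k) D\<^bsup>-pk\<^esup>\<close>. A step function with the values \<open>D\<^sup>k\<close>, \<open>i \<le> k \<le> j\<close>, on sets of measure
  proportional to \<open>D\<^bsup>-pk\<^esup>\<close> has a modular \<open>F\<close> with \<open>F (D\<^bsup>-l\<^esup>) / D\<^bsup>-pl\<^esup>\<close> equal to the ratio of the sums of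
  \<open>H\<close> over the windows \<open>[i - l, j - l]\<close> and \<open>[i, j]\<close>. These sums nearly agree as soon as \<open>H i\<close> and
  \<open>H j\<close> are small compared with the whole sum. If no window far out has this property, then the sums
  of \<open>H\<close> over intervals around a point grow geometrically with the radius, and \<open>H\<close> must double, or
  halve, along an arithmetic progression (\<open>doubling_or_halving\<close>). But then \<open>N\<close> grows at least like
  a power with exponent larger than \<open>p\<close>, or at most like one with exponent smaller than \<open>p\<close>, which
  contradicts \<open>\<alpha>\<^sub>N \<le> 1 / p \<le> \<beta>\<^sub>N\<close>. Hence \<open>s\<^sup>p\<close> can be approximated (\<open>power_approximation\<close>), and copies
  of the step function represent \<open>\<ell>\<^sup>p\<close>.
\<close>

section \<open>Orlicz functions and their inverses\<close>

locale orlicz =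
  fixes N :: "real \<Rightarrow> real"
  assumes orlicz: "orlicz_function N"
begin

lemma N_0 [simp]: "N 0 = 0"
  using orlicz by (simp add: orlicz_function_def)

lemma N_less: "0 \<le> x \<Longrightarrow> x < y \<Longrightarrow> N x < N y"
  using orlicz by (auto simp: orlicz_function_def strict_mono_on_def)

lemma N_le: "0 \<le> x \<Longrightarrow> x \<le> y \<Longrightarrow> N x \<le> N y"
  using N_less[of x y] by (cases "x = y") auto

lemma N_nonneg [simp]: "0 \<le> x \<Longrightarrow> 0 \<le> N x"
  using N_le[of 0 x] by simp

lemma N_pos [simp]: "0 < x \<Longrightarrow> 0 < N x"
  using N_less[of 0 x] by simp

lemma N_contract: "0 \<le> r \<Longrightarrow> r \<le> 1 \<Longrightarrow> 0 \<le> x \<Longrightarrow> N (r * x) \<le> r * N x"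
proof -
  assume r: "0 \<le> r" "r \<le> 1" "0 \<le> x"
  have "convex_on {0..} N"
    using orlicz by (simp add: orlicz_function_def)
  from convex_onD[OF this, of r 0 x] r show ?thesis by simp
qed

lemma N_dilate: "1 \<le> r \<Longrightarrow> 0 \<le> x \<Longrightarrow> r * N x \<le> N (r * x)"
  using N_contract[of "1 / r" "r * x"] by (simp add: field_simps)

lemma N_bij: "bij_betw N {0..} {0..}"
proof (intro bij_betw_imageI)
  show "inj_on N {0..}"
    using orlicz by (auto simp: orlicz_function_def intro: strict_mono_on_imp_inj_on)
  have cont: "continuous_on {0..} N"
    and top: "filterlim N at_top at_top"
    using orlicz by (auto simp: orlicz_function_def)
  have "y \<in> N ` {0..}" if y: "0 \<le> y" for y
  proof -
    have "eventually (\<lambda>x. y \<le> N x \<and> 0 \<le> x) at_top"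
      using top by (intro eventually_conj)
        (auto simp: filterlim_at_top eventually_ge_at_top)
    then obtain b where b: "y \<le> N b" "0 \<le> b"
      using eventually_happens'[OF trivial_limit_at_top_linorder] by blast
    have "continuous_on {0..b} N"
      using cont by (rule continuous_on_subset) auto
    then obtain x where "0 \<le> x" "N x = y"
      using IVT'[of N 0 y b] b y by auto
    then show ?thesis by auto
  qed
  then show "N ` {0..} = {0..}" by auto
qed

abbreviation \<phi> :: "real \<Rightarrow> real" where
  "\<phi> \<equiv> orlicz_inv N"

lemma N_inv [simp]: "0 \<le> y \<Longrightarrow> N (\<phi> y) = y"
  using N_bij f_the_inv_into_f_bij_betw[OF N_bij, of y] by (simp add: orlicz_inv_def)

lemma inv_nonneg [simp]: "0 \<le> y \<Longrightarrow> 0 \<le> \<phi> y"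
  using bij_betw_the_inv_into[OF N_bij] by (auto simp: orlicz_inv_def bij_betw_def)

lemma inv_le_iff: "0 \<le> y \<Longrightarrow> 0 \<le> x \<Longrightarrow> \<phi> y \<le> x \<longleftrightarrow> y \<le> N x"
  using N_le[of "\<phi> y" x] N_less[of x "\<phi> y"] by (auto simp: not_le[symmetric])

lemma le_inv_iff: "0 \<le> y \<Longrightarrow> 0 \<le> x \<Longrightarrow> x \<le> \<phi> y \<longleftrightarrow> N x \<le> y"
  using N_le[of x "\<phi> y"] N_less[of "\<phi> y" x] by (auto simp: not_le[symmetric])

lemma inv_pos [simp]: "0 < y \<Longrightarrow> 0 < \<phi> y"
  using inv_le_iff[of y 0] by (simp add: not_le[symmetric])

lemma inv_mono: "0 \<le> y \<Longrightarrow> y \<le> z \<Longrightarrow> \<phi> y \<le> \<phi> z"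
  by (simp add: inv_le_iff)

lemma inv_dilate: "1 \<le> r \<Longrightarrow> 0 \<le> y \<Longrightarrow> \<phi> (r * y) \<le> r * \<phi> y"
  using N_dilate[of r "\<phi> y"] by (simp add: inv_le_iff)

end

section \<open>Dyadic indices of positive sequences\<close>

text \<open>
  Fekete's lemma. Writing \<open>n = q m + r\<close> with \<open>r < m\<close> gives \<open>a n / n \<le> a m / m + M / n\<close> with
  \<open>M\<close> depending on \<open>m\<close> only, so the limit is the infimum of the quotients.
\<close>

lemma subadditive_quotients_convergent:
  fixes a :: "nat \<Rightarrow> real"
  assumes sub: "\<And>m n. a (m + n) \<le> a m + a n"
    and bdd: "\<And>n. K * real n \<le> a n"
  shows "convergent (\<lambda>n. 1 / real n * a n)"
proof -
  define l where "l = (INF n\<in>{1..}. a n / real n)"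
  have bb: "bdd_below ((\<lambda>n. a n / real n) ` {1..})"
    using bdd by (intro bdd_belowI2[of _ K]) (auto simp: field_simps)
  have l_le: "l \<le> a n / real n" if "1 \<le> n" for n
    unfolding l_def using bb that by (intro cINF_lower) auto
  have mult: "a (q * m + r) \<le> real q * a m + a r" for q m r
  proof (induction q)
    case (Suc q)
    have "a (Suc q * m + r) = a (m + (q * m + r))" by (simp add: algebra_simps)
    also have "\<dots> \<le> a m + a (q * m + r)" by (rule sub)
    finally show ?case using Suc by (simp add: algebra_simps)
  qed simp
  have "(\<lambda>n. a n / real n) \<longlonglongrightarrow> l"
  proof (rule LIMSEQ_I)
    fix e :: real assume e: "0 < e"
    obtain m where m: "1 \<le> m" "a m / real m < l + e / 2"
      using cINF_less_iff[OF _ bb, of "l + e / 2"] e by (auto simp: l_def)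
    define M where "M = (\<Sum>r<m. \<bar>a r\<bar> + \<bar>a m\<bar>)"
    obtain n0 :: nat where n0: "2 * M / e < real n0"
      using reals_Archimedean2 by blast
    show "\<exists>n0. \<forall>n\<ge>n0. norm (a n / real n - l) < e"
    proof (intro exI allI impI)
      fix n assume n: "max 1 n0 \<le> n"
      define q r where "q = n div m" and "r = n mod m"
      have nqr: "n = q * m + r" and r: "r < m"
        using m by (auto simp: q_def r_def)
      have rM: "\<bar>a r\<bar> + \<bar>a m\<bar> \<le> M"
        unfolding M_def using r by (intro member_le_sum) auto
      have qn: "real q = (real n - real r) / real m"
        using m nqr by (simp add: field_simps)
      have "\<bar>real r / real m * a m\<bar> \<le> 1 * \<bar>a m\<bar>"
        unfolding abs_mult using r by (intro mult_right_mono) auto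
      then have "- (real r / real m * a m) \<le> \<bar>a m\<bar>"
        by linarith
      moreover have "a n \<le> real q * a m + a r"
        using mult[of q m r] nqr by simp
      moreover have "real q * a m = real n * (a m / real m) - real r / real m * a m"
        by (simp add: qn diff_divide_distrib left_diff_distrib)
      ultimately have "a n \<le> real n * (a m / real m) + M"
        using rM by linarith
      also have "\<dots> \<le> real n * (l + e / 2) + M"
        using m by (intro add_right_mono mult_left_mono) auto
      also have "M < real n * (e / 2)"
      proof -
          have "2 * M / e < real n" using n0 n by linarith
          then show ?thesis using e by (simp add: field_simps)
        qed
      finally have "a n < real n * (l + e)" by (simp add: algebra_simps)
      then have "a n / real n < l + e" using n by (simp add: field_simps)
      moreover have "l \<le> a n / real n" using n by (intro l_le) auto
      ultimately show "norm (a n / real n - l) < e" by simp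
    qed
  qed
  then show ?thesis by (auto simp: convergent_def)
qed

text \<open>
  Both indices of \<open>N\<close> are instances of one construction: \<open>c j = N\<^sup>-\<^sup>1 (2\<^sup>j)\<close> gives \<open>- \<alpha>\<^sub>N\<close> and its
  reciprocal gives \<open>\<beta>\<^sub>N\<close>. The index \<open>j\<close> is \<open>k - n\<close> in terms of the defining formulas of the indices.
\<close>

definition dyadic_sup :: "(nat \<Rightarrow> real) \<Rightarrow> nat \<Rightarrow> real" where
  "dyadic_sup c n = (SUP j. c j / c (j + n))"

definition dyadic_index :: "(nat \<Rightarrow> real) \<Rightarrow> real" where
  "dyadic_index c = lim (\<lambda>n. 1 / real n * log 2 (dyadic_sup c n))"

text \<open>
  This confines the suprema to \<open>[K\<^bsup>-n\<^esup>, K\<^bsup>n\<^esup>]\<close>, so that their logarithms are at most linear in \<open>n\<close>.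
\<close>

definition bounded_ratios :: "(nat \<Rightarrow> real) \<Rightarrow> bool" where
  "bounded_ratios c \<longleftrightarrow>
     (\<forall>j. 0 < c j) \<and> (\<exists>K\<ge>1. \<forall>j. c j \<le> K * c (Suc j) \<and> c (Suc j) \<le> K * c j)"

lemma bounded_ratios_power:
  assumes "bounded_ratios c"
  obtains K where "1 \<le> K" "\<And>j n. c j \<le> K ^ n * c (j + n)" "\<And>j n. c (j + n) \<le> K ^ n * c j"
proof -
  obtain K where K: "1 \<le> K" "\<And>j. c j \<le> K * c (Suc j)" "\<And>j. c (Suc j) \<le> K * c j"
    using assms by (auto simp: bounded_ratios_def)
  have "c j \<le> K ^ n * c (j + n)" for j n
  proof (induction n)
    case (Suc n)
    also have "K ^ n * c (j + n) \<le> K ^ n * (K * c (Suc (j + n)))"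
      using K by (intro mult_left_mono) auto
    finally show ?case by (simp add: mult_ac)
  qed simp
  moreover have "c (j + n) \<le> K ^ n * c j" for j n
  proof (induction n)
    case (Suc n)
    have "c (j + Suc n) \<le> K * c (j + n)" using K by simp
    also have "\<dots> \<le> K * (K ^ n * c j)" using K Suc by (intro mult_left_mono) auto
    finally show ?case by (simp add: mult_ac)
  qed simp
  ultimately show ?thesis using K(1) that by blast
qed

context
  fixes c :: "nat \<Rightarrow> real"
  assumes c: "bounded_ratios c"
begin

lemma c_pos [simp]: "0 < c j"
  using c by (simp add: bounded_ratios_def)

lemma dyadic_sup_upper: "c j \<le> dyadic_sup c n * c (j + n)"
proof -
  obtain K where "\<And>j n. c j \<le> K ^ n * c (j + n)"
    using bounded_ratios_power[OF c] by metis
  then have "bdd_above (range (\<lambda>j. c j / c (j + n)))"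
    by (intro bdd_aboveI2[of _ _ "K ^ n"]) (simp add: divide_le_eq)
  from cSUP_upper[OF UNIV_I this, of j] show ?thesis
    by (simp add: dyadic_sup_def divide_le_eq)
qed

lemma dyadic_sup_least: "(\<And>j. c j \<le> B * c (j + n)) \<Longrightarrow> dyadic_sup c n \<le> B"
  unfolding dyadic_sup_def by (intro cSUP_least) (auto simp: divide_le_eq)

lemma dyadic_sup_pos [simp]: "0 < dyadic_sup c n"
  using dyadic_sup_upper[of 0 n] c_pos[of 0] c_pos[of n]
  by (metis add_0 less_le_trans zero_less_mult_pos2)

text \<open>
  A shift by \<open>m + n\<close> is a shift by \<open>m\<close> followed by one by \<open>n\<close>. Thus the logarithms are subadditive.
\<close>

lemma dyadic_sup_submult: "dyadic_sup c (m + n) \<le> dyadic_sup c m * dyadic_sup c n"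
proof (rule dyadic_sup_least)
  fix j
  have "c j \<le> dyadic_sup c m * c (j + m)" by (rule dyadic_sup_upper)
  also have "\<dots> \<le> dyadic_sup c m * (dyadic_sup c n * c (j + m + n))"
    by (intro mult_left_mono dyadic_sup_upper) (simp add: less_imp_le)
  finally show "c j \<le> dyadic_sup c m * dyadic_sup c n * c (j + (m + n))"
    by (simp add: add_ac mult_ac)
qed

lemma dyadic_index_LIMSEQ:
  "(\<lambda>n. 1 / real n * log 2 (dyadic_sup c n)) \<longlonglongrightarrow> dyadic_index c"
proof -
  obtain K where K: "1 \<le> K" "\<And>j n. c (j + n) \<le> K ^ n * c j"
    using bounded_ratios_power[OF c] by metis
  have "convergent (\<lambda>n. 1 / real n * log 2 (dyadic_sup c n))"
  proof (rule subadditive_quotients_convergent)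
    fix m n
    have "log 2 (dyadic_sup c (m + n)) \<le> log 2 (dyadic_sup c m * dyadic_sup c n)"
      using dyadic_sup_submult by simp
    also have "\<dots> = log 2 (dyadic_sup c m) + log 2 (dyadic_sup c n)"
      by (intro log_mult_pos) auto
    finally show "log 2 (dyadic_sup c (m + n)) \<le> log 2 (dyadic_sup c m) + log 2 (dyadic_sup c n)" .
    have "c n \<le> K ^ n * c 0"
      using K(2)[of 0 n] by simp
    also have "\<dots> \<le> K ^ n * (dyadic_sup c n * c n)"
      using K(1) dyadic_sup_upper[of 0 n] by (intro mult_left_mono) auto
    finally have "c n \<le> K ^ n * (dyadic_sup c n * c n)" .
    then have "1 * c n \<le> (K ^ n * dyadic_sup c n) * c n"
      by simp
    then have "1 \<le> K ^ n * dyadic_sup c n"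
      using c_pos[of n] by (simp only: mult_le_cancel_right_pos)
    then have "0 \<le> log 2 (K ^ n * dyadic_sup c n)"
      by simp
    also have "\<dots> = log 2 (K ^ n) + log 2 (dyadic_sup c n)"
      using K(1) by (intro log_mult_pos) auto
    finally show "- log 2 K * real n \<le> log 2 (dyadic_sup c n)"
      using K(1) by (simp add: log_nat_power mult.commute)
  qed
  then show ?thesis
    by (simp add: dyadic_index_def convergent_LIMSEQ_iff)
qed

text \<open>
  The limit gives the estimate with \<open>A = 1\<close> for all large \<open>n\<close>; the constant absorbs the finitely
  many other values of \<open>n\<close>.
\<close>

lemma dyadic_index_lessD:
  assumes "dyadic_index c < x"
  obtains A where "1 \<le> A" "\<And>n j. c j \<le> A * 2 powr (x * real n) * c (j + n)"
proof -
  have "eventually (\<lambda>n. 1 / real n * log 2 (dyadic_sup c n) < x) sequentially"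
    using dyadic_index_LIMSEQ assms by (rule order_tendstoD)
  then obtain n0 where n0: "\<And>n. n0 \<le> n \<Longrightarrow> 1 / real n * log 2 (dyadic_sup c n) < x"
    by (auto simp: eventually_sequentially)
  \<comment> \<open>the leading \<open>1\<close> serves the \<open>n\<close> beyond \<open>n0\<close>\<close>
  define A where "A = 1 + (\<Sum>n\<le>n0. dyadic_sup c n / 2 powr (x * real n))"
  have nn: "0 \<le> (\<Sum>n\<le>n0. dyadic_sup c n / 2 powr (x * real n))"
    by (intro sum_nonneg) (simp add: less_imp_le)
  have "dyadic_sup c n \<le> A * 2 powr (x * real n)" for n
  proof (cases "n \<le> n0")
    case True
    have "dyadic_sup c n / 2 powr (x * real n) \<le> (\<Sum>n\<le>n0. dyadic_sup c n / 2 powr (x * real n))"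
      using True by (intro member_le_sum) (auto simp: less_imp_le)
    then have "dyadic_sup c n / 2 powr (x * real n) \<le> A" by (simp add: A_def)
    then show ?thesis by (simp add: divide_le_eq)
  next
    case False
    then have "log 2 (dyadic_sup c n) \<le> x * real n"
      using n0[of n] by (simp add: field_simps)
    then have "dyadic_sup c n \<le> 1 * 2 powr (x * real n)"
      by (simp add: log_le_iff)
    also have "\<dots> \<le> A * 2 powr (x * real n)"
      using nn by (intro mult_right_mono) (auto simp: A_def)
    finally show ?thesis .
  qed
  then have "dyadic_sup c n * c (j + n) \<le> A * 2 powr (x * real n) * c (j + n)" for j n
    by (intro mult_right_mono) (auto simp: less_imp_le)
  then have "c j \<le> A * 2 powr (x * real n) * c (j + n)" for j n
    using dyadic_sup_upper order_trans by blast
  moreover have "1 \<le> A" using nn by (simp add: A_def)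
  ultimately show ?thesis using that by blast
qed

lemma dyadic_index_leI:
  assumes A: "0 < A" and le: "\<And>n j. c j \<le> A * 2 powr (x * real n) * c (j + n)"
  shows "dyadic_index c \<le> x"
proof (rule LIMSEQ_le)
  show "(\<lambda>n. 1 / real n * log 2 (dyadic_sup c n)) \<longlonglongrightarrow> dyadic_index c"
    by (rule dyadic_index_LIMSEQ)
  show "(\<lambda>n. 1 / real n * log 2 A + x) \<longlonglongrightarrow> x"
    by (rule tendsto_eq_intros lim_1_over_n refl | simp)+
  have "1 / real n * log 2 (dyadic_sup c n) \<le> 1 / real n * log 2 A + x" if "1 \<le> n" for n
  proof -
    have "dyadic_sup c n \<le> A * 2 powr (x * real n)"
      using le by (rule dyadic_sup_least)
    then have "log 2 (dyadic_sup c n) \<le> log 2 (A * 2 powr (x * real n))"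
      using A by simp
    then have "log 2 (dyadic_sup c n) \<le> log 2 A + x * real n"
      using A by (simp add: log_mult)
    then show ?thesis using that by (simp add: field_simps)
  qed
  then show "\<exists>n0. \<forall>n\<ge>n0. 1 / real n * log 2 (dyadic_sup c n) \<le> 1 / real n * log 2 A + x"
    by blast
qed

end

section \<open>Indices and power growth\<close>

lemma SUP_int_atLeast:
  "(SUP k\<in>{int n..}. g (2 powi (k - int n)) (2 powi k)) = (SUP j. g (2 ^ j) (2 ^ (j + n)))"
  for g :: "real \<Rightarrow> real \<Rightarrow> real"
proof -
  have "k \<in> range (\<lambda>j. int (j + n))" if "int n \<le> k" for k
    using that by (intro image_eqI[of _ _ "nat (k - int n)"]) auto
  then have "{int n..} = range (\<lambda>j. int (j + n))"
    by auto
  moreover have "2 powi (int (j + n) - int n) = (2 :: real) ^ j" "2 powi int (j + n) = (2 :: real) ^ (j + n)" for j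
    by (simp_all del: of_nat_add add: power_int_of_nat) (simp add: power_int_of_nat)
  ultimately show ?thesis by (simp only: image_image)
qed

context orlicz
begin

text \<open>
  Growth like a power at infinity, up to constants. The two properties replace the indices in all
  arguments about \<open>N\<close>: they do not refer to the inverse function or to dyadic arguments, and they can
  be integrated.
\<close>

definition grows_at_least :: "real \<Rightarrow> bool" where
  "grows_at_least q \<longleftrightarrow> (\<exists>c>0. \<exists>V>0. \<forall>w\<ge>V. \<forall>R\<ge>1. c * R powr q * N w \<le> N (R * w))"

definition grows_at_most :: "real \<Rightarrow> bool" where
  "grows_at_most q \<longleftrightarrow> (\<exists>C>0. \<exists>V>0. \<forall>w\<ge>V. \<forall>R\<ge>1. N (R * w) \<le> C * R powr q * N w)"

text \<open>
  The suprema in the indices run over all arguments of \<open>N\<^sup>-\<^sup>1\<close> from \<open>1\<close> on, whereas growth is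
  a statement about large arguments. The two meet because on a compact subset of \<open>(0, \<infinity>)\<close> both \<open>N\<close>
  and the powers vary by bounded factors only.
\<close>

lemma grows_at_least_from:
  fixes q W :: real
  assumes "grows_at_least q" "0 < W" "0 \<le> q"
  shows "\<exists>c>0. \<forall>w\<ge>W. \<forall>R\<ge>1. c * R powr q * N w \<le> N (R * w)"
proof -
  obtain c0 V0 :: real where c0: "0 < c0" and V0: "0 < V0"
    and gr0: "\<And>w (R :: real). V0 \<le> w \<Longrightarrow> 1 \<le> R \<Longrightarrow> c0 * R powr q * N w \<le> N (R * w)"
    using assms(1) by (auto simp: grows_at_least_def)
  define V c1 where "V = max V0 W" and "c1 = min c0 1"
  have V: "W \<le> V" "0 < V" and c1: "0 < c1" "c1 \<le> 1"
    using V0 c0 by (auto simp: V_def c1_def)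
  have gr: "c1 * R powr q * N w \<le> N (R * w)" if "V \<le> w" "1 \<le> R" for w R :: real
  proof -
    have "c1 * (R powr q * N w) \<le> c0 * (R powr q * N w)"
      using that V by (intro mult_right_mono) (auto simp: c1_def simp del: mult_le_cancel_right)
    moreover have "c0 * R powr q * N w \<le> N (R * w)"
      using gr0 that by (simp add: V_def)
    ultimately show ?thesis by (simp only: mult.assoc)
  qed
  show ?thesis
  proof (intro exI conjI allI impI)
    show "0 < c1 * (W / V) powr q" using c1 assms V by simp
    fix w R :: real assume w: "W \<le> w" and R: "1 \<le> R"
    have pos: "0 \<le> N w" "0 < w" using w assms by auto
    show "c1 * (W / V) powr q * R powr q * N w \<le> N (R * w)"
    proof (cases "V \<le> R * w")
      case True
      show ?thesis
      proof (cases "V \<le> w")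
        case True
        have "(W / V) powr q * (c1 * R powr q * N w) \<le> 1 * (c1 * R powr q * N w)"
          using V assms pos c1 by (intro mult_right_mono powr_le1) auto
        then show ?thesis using gr[OF True R] by (simp add: mult_ac)
      next
        case False
        have "c1 * ((W / V) powr q * R powr q * N w) = c1 * ((R * W / V) powr q * N w)"
          using R assms V by (simp add: powr_mult[symmetric] mult_ac)
        also have "\<dots> \<le> c1 * ((R * w / V) powr q * N V)"
          using R w False V c1 assms pos
          by (intro mult_left_mono mult_mono powr_mono2 divide_right_mono N_le) auto
        also have "\<dots> \<le> N (R * w / V * V)"
          using gr[of V "R * w / V"] True V by (simp add: mult.assoc)
        finally show ?thesis using V by (simp add: mult_ac)
      qed
    next
      case False
      have "c1 * ((W / V) powr q * R powr q * N w) \<le> 1 * (1 * N w)"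
      proof (intro mult_mono)
        have "R * W \<le> R * w" using R w by simp
        then have "W / V * R \<le> 1" using False V by (simp add: field_simps)
        then have "(W / V * R) powr q \<le> 1"
          using R V assms by (intro powr_le1) auto
        then show "(W / V) powr q * R powr q \<le> 1"
          using R V assms by (simp add: powr_mult[symmetric])
      qed (use c1 pos in auto)
      also have "\<dots> \<le> N (R * w)" using R pos by (simp add: N_le)
      finally show ?thesis by (simp add: mult_ac)
    qed
  qed
qed

lemma grows_at_most_from:
  fixes q W :: real
  assumes "grows_at_most q" "0 < W" "0 \<le> q"
  shows "\<exists>C>0. \<forall>w\<ge>W. \<forall>R\<ge>1. N (R * w) \<le> C * R powr q * N w"
proof -
  obtain C0 V0 :: real where C0: "0 < C0" and V0: "0 < V0"
    and gr0: "\<And>w (R :: real). V0 \<le> w \<Longrightarrow> 1 \<le> R \<Longrightarrow> N (R * w) \<le> C0 * R powr q * N w"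
    using assms(1) by (auto simp: grows_at_most_def)
  define V where "V = max V0 W"
  have V: "W \<le> V" "0 < V" using V0 by (auto simp: V_def)
  show ?thesis
  proof (intro exI conjI allI impI)
    show "0 < C0 * (N V / N W)" using C0 V assms by simp
    fix w R :: real assume w: "W \<le> w" and R: "1 \<le> R"
    have NW: "0 < N W" "N W \<le> N w" "0 < N w" "N W \<le> N V"
      using w assms V by (auto intro: N_le)
    show "N (R * w) \<le> C0 * (N V / N W) * R powr q * N w"
    proof (cases "V \<le> w")
      case True
      have "N (R * w) \<le> C0 * R powr q * N w" using gr0 True R by (simp add: V_def)
      also have "\<dots> = (C0 * R powr q) * (1 * N w)" by simp
      also have "\<dots> \<le> (C0 * R powr q) * (N V / N W * N w)"
        using NW C0 by (intro mult_left_mono mult_right_mono) auto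
      finally show ?thesis by (simp add: mult_ac)
    next
      case False
      then have "N (R * w) \<le> N (R * V)" using R w assms by (intro N_le) auto
      also have "\<dots> \<le> C0 * R powr q * N V" using gr0 R by (simp add: V_def)
      also have "\<dots> = C0 * R powr q * (N V / N W * N W)" using NW by simp
      also have "\<dots> \<le> C0 * R powr q * (N V / N W * N w)"
        using NW C0 V by (intro mult_left_mono) auto
      finally show ?thesis by (simp add: mult_ac)
    qed
  qed
qed

lemma inv_dyadic_step: "\<phi> (2 ^ Suc j) \<le> 2 * \<phi> (2 ^ j)"
  using inv_dilate[of 2 "2 ^ j"] by simp

lemma inv_dyadic_mono: "i \<le> j \<Longrightarrow> \<phi> (2 ^ i) \<le> \<phi> (2 ^ j)"
  by (intro inv_mono) auto

lemma bounded_ratios_inv: "bounded_ratios (\<lambda>j. \<phi> (2 ^ j))"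
proof -
  have "\<phi> (2 ^ j) \<le> 2 * \<phi> (2 ^ Suc j)" for j
  proof -
    have "0 < \<phi> (2 ^ Suc j)" by simp
    then show ?thesis using inv_dyadic_mono[of j "Suc j"] by linarith
  qed
  then show ?thesis
    unfolding bounded_ratios_def using inv_dyadic_step
    by (intro conjI allI exI[of _ 2]) (auto simp del: power_Suc)
qed

lemma bounded_ratios_inverse: "bounded_ratios c \<Longrightarrow> bounded_ratios (\<lambda>j. 1 / c j)"
proof -
  assume c: "bounded_ratios c"
  then obtain K where K: "1 \<le> K" "\<And>j. c j \<le> K * c (Suc j)" "\<And>j. c (Suc j) \<le> K * c j"
    and pos: "\<And>j. 0 < c j"
    by (auto simp: bounded_ratios_def)
  have "1 / c j \<le> K * (1 / c (Suc j))" "1 / c (Suc j) \<le> K * (1 / c j)" for j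
    using K(2,3)[of j] pos[of j] pos[of "Suc j"] by (simp_all add: divide_simps mult_ac)
  then show ?thesis
    using K(1) pos by (auto simp: bounded_ratios_def)
qed

lemma alpha_eq: "orlicz_alpha N = - dyadic_index (\<lambda>j. \<phi> (2 ^ j))"
  unfolding orlicz_alpha_def dyadic_index_def dyadic_sup_def
  by (simp only: SUP_int_atLeast[where g = "\<lambda>x y. \<phi> x / \<phi> y"])

lemma beta_eq: "orlicz_beta N = dyadic_index (\<lambda>j. 1 / \<phi> (2 ^ j))"
  unfolding orlicz_beta_def dyadic_index_def dyadic_sup_def
  by (simp only: SUP_int_atLeast[where g = "\<lambda>x y. \<phi> y / \<phi> x"] divide_divide_eq_right times_divide_eq_left mult_1 div_by_1)

end

text \<open>
  Places a number between consecutive terms of a geometric progression; this is how estimates on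
  a progression pass to all arguments.
\<close>

lemma geometric_bracket:
  fixes y D :: real
  assumes "1 < D" "1 \<le> y"
  obtains j :: nat where "D ^ j \<le> y" "y < D ^ Suc j"
proof -
  obtain n where n: "y < D ^ n"
    using real_arch_pow[OF assms(1)] by blast
  define m where "m = (LEAST n. y < D ^ n)"
  have m: "y < D ^ m" unfolding m_def using n by (rule LeastI)
  then obtain j where j: "m = Suc j"
    using assms by (cases m) auto
  have "\<not> y < D ^ j"
    using not_less_Least[of j "\<lambda>n. y < D ^ n"] j by (simp add: m_def)
  then show ?thesis using that m j by (auto simp: not_less)
qed

lemma power_powr_swap: "0 < D \<Longrightarrow> (D ^ r) powr q = (D powr q) ^ r" for D q :: real
  by (simp add: powr_realpow[symmetric] powr_powr mult.commute)

context orlicz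
begin

text \<open>
  Since \<open>N\<close> is increasing, growth along one geometric progression suffices. Rounding \<open>w\<close> and \<open>R\<close> to the
  progression costs one factor \<open>D\<^sup>q\<close> each, hence the constant \<open>D\<^bsup>-2q\<^esup>\<close>.
\<close>

lemma grows_at_leastI_geometric:
  assumes D: "1 < D" and v: "0 < v" and q: "0 \<le> q"
    and step: "\<And>t. D powr q * N (v * D ^ t) \<le> N (v * D ^ Suc t)"
  shows "grows_at_least q"
proof -
  define K where "K = D powr q"
  have K: "1 \<le> K" using D q by (simp add: K_def ge_one_powr_ge_zero)
  have iter: "K ^ r * N (v * D ^ t) \<le> N (v * D ^ (t + r))" for r t
  proof (induction r)
    case (Suc r)
    have "K ^ Suc r * N (v * D ^ t) = K * (K ^ r * N (v * D ^ t))" by simp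
    also have "\<dots> \<le> K * N (v * D ^ (t + r))" using K Suc by (intro mult_left_mono) auto
    also have "\<dots> \<le> N (v * D ^ (t + Suc r))" using step[of "t + r"] by (simp add: K_def)
    finally show ?case .
  qed simp
  have main: "1 / K ^ 2 * R powr q * N w \<le> N (R * w)" if w: "v \<le> w" and R: "1 \<le> R" for w R
  proof -
    obtain a where a: "D ^ a \<le> w / v" "w / v < D ^ Suc a"
      using geometric_bracket[OF D, of "w / v"] w v by (auto simp: le_divide_eq)
    obtain r where r: "D ^ r \<le> R" "R < D ^ Suc r"
      using geometric_bracket[OF D R] by blast
    have w': "v * D ^ a \<le> w" "w \<le> v * D ^ Suc a"
      using a v by (auto simp: field_simps)
    have "R powr q \<le> (D ^ Suc r) powr q"
      using r R q by (intro powr_mono2) auto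
    also have "\<dots> = K ^ Suc r"
      unfolding K_def using D by (intro power_powr_swap) auto
    finally have "1 / K ^ 2 * R powr q * N w \<le> 1 / K ^ 2 * K ^ Suc r * N w"
      using K w v by (intro mult_right_mono mult_left_mono) auto
    also have "\<dots> \<le> N (R * w)"
    proof (cases r)
      case 0
      have "1 / K ^ 2 * K ^ Suc r * N w \<le> 1 * N w"
        using K w v 0 by (intro mult_right_mono) (auto simp: power2_eq_square)
      also have "\<dots> \<le> N (R * w)" using R w v by (simp add: N_le)
      finally show ?thesis .
    next
      case (Suc r')
      have "1 / K ^ 2 * K ^ Suc r * N w = K ^ r' * N w"
        using K Suc by (simp add: power2_eq_square)
      also have "\<dots> \<le> K ^ r' * N (v * D ^ Suc a)"
        using K w w' v by (intro mult_left_mono N_le) auto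
      also have "\<dots> \<le> N (D ^ r * (v * D ^ a))"
        using iter[of r' "Suc a"] Suc by (simp add: power_add mult_ac)
      also have "\<dots> \<le> N (R * w)"
        using r w' v D R by (intro N_le mult_mono) auto
      finally show ?thesis .
    qed
    finally show ?thesis .
  qed
  show ?thesis
    unfolding grows_at_least_def
    using main K v by (intro exI[of _ "1 / K ^ 2"] exI[of _ v] conjI) auto
qed

lemma grows_at_mostI_geometric:
  assumes D: "1 < D" and v: "0 < v" and q: "0 \<le> q"
    and step: "\<And>t. N (v * D ^ Suc t) \<le> D powr q * N (v * D ^ t)"
  shows "grows_at_most q"
proof -
  define K where "K = D powr q"
  have K: "1 \<le> K" using D q by (simp add: K_def ge_one_powr_ge_zero)
  have iter: "N (v * D ^ (t + r)) \<le> K ^ r * N (v * D ^ t)" for r t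
  proof (induction r)
    case (Suc r)
    have "N (v * D ^ (t + Suc r)) \<le> K * N (v * D ^ (t + r))"
      using step[of "t + r"] by (simp add: K_def)
    also have "\<dots> \<le> K * (K ^ r * N (v * D ^ t))" using K Suc by (intro mult_left_mono) auto
    finally show ?case by (simp add: mult.assoc)
  qed simp
  have main: "N (R * w) \<le> K ^ 2 * R powr q * N w" if w: "v \<le> w" and R: "1 \<le> R" for w R
  proof -
    obtain a where a: "D ^ a \<le> w / v" "w / v < D ^ Suc a"
      using geometric_bracket[OF D, of "w / v"] w v by (auto simp: le_divide_eq)
    obtain r where r: "D ^ r \<le> R" "R < D ^ Suc r"
      using geometric_bracket[OF D R] by blast
    have w': "v * D ^ a \<le> w" "w \<le> v * D ^ Suc a"
      using a v by (auto simp: field_simps)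
    have "N (R * w) \<le> N (D ^ Suc r * (v * D ^ Suc a))"
      using r w' v D R w by (intro N_le mult_mono) auto
    also have "\<dots> \<le> K ^ (r + 2) * N (v * D ^ a)"
      using iter[of a "r + 2"] by (simp add: power_add mult_ac power2_eq_square)
    also have "\<dots> \<le> K ^ (r + 2) * N w"
      using K w' v D by (intro mult_left_mono N_le) auto
    also have "\<dots> = K ^ 2 * K ^ r * N w"
      by (simp add: power_add mult_ac power2_eq_square)
    also have "K ^ r = (D ^ r) powr q"
      unfolding K_def using D by (intro power_powr_swap[symmetric]) auto
    also have "\<dots> \<le> R powr q"
      using r R q D by (intro powr_mono2) auto
    finally show ?thesis
      using K w v by (simp add: mult_right_mono mult_left_mono)
  qed
  show ?thesis
    unfolding grows_at_most_def
    using main K v by (intro exI[of _ "K ^ 2"] exI[of _ v] conjI) auto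
qed

text \<open>
  Rounds \<open>N w\<close> and \<open>N (R w) / 2\<^sup>j\<close> down to powers of \<open>2\<close>. Each of the bounds on values of \<open>N\<close> is
  listed together with its equivalent in terms of \<open>\<phi>\<close>.
\<close>

lemma dyadic_bracket:
  assumes w: "\<phi> 1 \<le> w" and R: "1 \<le> R"
  obtains j n where "\<phi> (2 ^ j) \<le> w" "w \<le> \<phi> (2 ^ Suc j)" "2 ^ j \<le> N w" "N w \<le> 2 ^ Suc j"
    "\<phi> (2 ^ (j + n)) \<le> R * w" "R * w \<le> \<phi> (2 ^ (j + Suc n))"
    "2 ^ (j + n) \<le> N (R * w)" "N (R * w) \<le> 2 ^ (j + Suc n)"
proof -
  have w0: "0 < w" using w inv_pos[of 1] by linarith
  have "1 \<le> N w" using w w0 by (simp add: inv_le_iff)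
  then obtain j where j: "2 ^ j \<le> N w" "N w < 2 ^ Suc j"
    using geometric_bracket[of 2 "N w"] by auto
  have "N w \<le> N (R * w)" using w0 R by (intro N_le) auto
  then have "1 \<le> N (R * w) / 2 ^ j" using j by (simp add: le_divide_eq)
  then obtain n where n: "2 ^ n \<le> N (R * w) / 2 ^ j" "N (R * w) / 2 ^ j < 2 ^ Suc n"
    using geometric_bracket[of 2 "N (R * w) / 2 ^ j"] by auto
  have "2 ^ (j + n) \<le> N (R * w)" "N (R * w) \<le> 2 ^ (j + Suc n)"
    using n by (simp_all add: field_simps power_add)
  then show ?thesis
    using j w0 R by (intro that) (auto simp: inv_le_iff le_inv_iff)
qed

text \<open>
  If \<open>\<beta>\<^sub>N < 1 / q\<close>, then multiplying the argument of \<open>\<phi>\<close> by \<open>2\<^sup>n\<close> multiplies its value by at most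
  a constant times \<open>2\<^bsup>n/q\<^esup>\<close>. Read backwards, multiplying the argument of \<open>N\<close> by \<open>R\<close> multiplies its value by
  at least a constant times \<open>R\<^sup>q\<close>.
\<close>

lemma grows_at_least_if_beta_less:
  assumes q: "0 < q" and beta: "orlicz_beta N < 1 / q"
  shows "grows_at_least q"
proof -
  obtain A where A: "1 \<le> A"
    and "\<And>n j. 1 / \<phi> (2 ^ j) \<le> A * 2 powr (1 / q * real n) * (1 / \<phi> (2 ^ (j + n)))"
    using dyadic_index_lessD[OF bounded_ratios_inverse[OF bounded_ratios_inv], of "1 / q"] beta
    unfolding beta_eq by metis
  then have inv_le: "\<phi> (2 ^ (j + n)) \<le> A * 2 powr (1 / q * real n) * \<phi> (2 ^ j)" for j n
    by (simp add: divide_simps mult_ac)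
  have main: "1 / (4 * A powr q) * R powr q * N w \<le> N (R * w)"
    if w: "\<phi> 1 \<le> w" and R: "1 \<le> R" for w R
  proof -
    obtain j n where jn: "\<phi> (2 ^ j) \<le> w" "N w \<le> 2 ^ Suc j"
      "R * w \<le> \<phi> (2 ^ (j + Suc n))" "2 ^ (j + n) \<le> N (R * w)"
      using dyadic_bracket[OF w R] by metis
    have w0: "0 < w" using w inv_pos[of 1] by linarith
    have "R * w \<le> A * 2 powr (1 / q * real (Suc n)) * \<phi> (2 ^ j)"
      using jn(3) inv_le order_trans by blast
    also have "\<dots> \<le> A * 2 powr (1 / q * real (Suc n)) * w"
      using A jn(1) by (intro mult_left_mono) auto
    finally have "R \<le> A * 2 powr (1 / q * real (Suc n))"
      using w0 by simp
    then have "R powr q \<le> (A * 2 powr (1 / q * real (Suc n))) powr q"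
      using R q by (intro powr_mono2) auto
    also have "\<dots> = A powr q * 2 powr (real (Suc n))"
      using A q by (simp add: powr_mult powr_powr)
    also have "\<dots> = A powr q * 2 ^ Suc n"
      by (subst powr_realpow) auto
    finally have Rq: "R powr q \<le> A powr q * 2 ^ Suc n" .
    have "1 / (4 * A powr q) * R powr q * N w \<le> 1 / (4 * A powr q) * (A powr q * 2 ^ Suc n) * 2 ^ Suc j"
      using Rq jn(2) A w0 by (intro mult_mono) auto
    also have "\<dots> = 2 ^ (j + n)"
      using A by (simp add: power_add)
    also have "\<dots> \<le> N (R * w)" by (rule jn)
    finally show ?thesis .
  qed
  show ?thesis
    unfolding grows_at_least_def
    using main A by (intro exI[of _ "1 / (4 * A powr q)"] exI[of _ "\<phi> 1"] conjI) auto
qed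

text \<open>
  The dual reading: a lower bound on the growth of \<open>\<phi>\<close> is an upper bound on the growth of \<open>N\<close>.
\<close>

lemma grows_at_most_if_less_alpha:
  assumes q: "0 < q" and alpha: "1 / q < orlicz_alpha N"
  shows "grows_at_most q"
proof -
  have "dyadic_index (\<lambda>j. \<phi> (2 ^ j)) < - (1 / q)"
    using alpha by (simp add: alpha_eq)
  then obtain A where A: "1 \<le> A"
    and inv_le: "\<And>n j. \<phi> (2 ^ j) \<le> A * 2 powr (- (1 / q) * real n) * \<phi> (2 ^ (j + n))"
    using dyadic_index_lessD[OF bounded_ratios_inv] by blast
  have main: "N (R * w) \<le> (2 * (2 * A) powr q) * R powr q * N w"
    if w: "\<phi> 1 \<le> w" and R: "1 \<le> R" for w R
  proof -
    obtain j n where jn: "w \<le> \<phi> (2 ^ Suc j)" "2 ^ j \<le> N w"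
      "\<phi> (2 ^ (j + n)) \<le> R * w" "N (R * w) \<le> 2 ^ (j + Suc n)"
      using dyadic_bracket[OF w R] by metis
    have w0: "0 < w" using w inv_pos[of 1] by linarith
    have "w \<le> 2 * \<phi> (2 ^ j)" using jn(1) inv_dyadic_step[of j] by linarith
    also have "\<dots> \<le> 2 * (A * 2 powr (- (1 / q) * real n) * \<phi> (2 ^ (j + n)))"
      using inv_le by simp
    also have "\<dots> \<le> 2 * (A * 2 powr (- (1 / q) * real n) * (R * w))"
      using A jn(3) by (intro mult_left_mono) auto
    finally have "1 * w \<le> (2 * A * R * 2 powr (- (1 / q) * real n)) * w"
      by (simp add: mult_ac)
    then have "1 \<le> 2 * A * R * 2 powr (- (1 / q) * real n)"
      using w0 by (simp only: mult_le_cancel_right_pos)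
    then have "2 powr (1 / q * real n) \<le> 2 * A * R"
      by (simp add: powr_minus field_simps)
    then have "(2 powr (1 / q * real n)) powr q \<le> (2 * A * R) powr q"
      using q by (intro powr_mono2) auto
    moreover have "(2 powr (1 / q * real n)) powr q = 2 ^ n"
      using q by (simp add: powr_powr powr_realpow)
    moreover have "(2 * A * R) powr q = (2 * A) powr q * R powr q"
      using A R by (simp add: powr_mult)
    ultimately have Rq: "2 ^ n \<le> (2 * A) powr q * R powr q" by simp
    have "N (R * w) \<le> 2 * 2 ^ n * 2 ^ j" using jn(4) by (simp add: power_add mult_ac)
    also have "\<dots> \<le> 2 * ((2 * A) powr q * R powr q) * N w"
      using Rq jn(2) by (intro mult_mono) auto
    finally show ?thesis by (simp add: mult_ac)
  qed
  show ?thesis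
    unfolding grows_at_most_def
    using main A by (intro exI[of _ "2 * (2 * A) powr q"] exI[of _ "\<phi> 1"] conjI) auto
qed

lemma beta_le_if_grows_at_least:
  assumes q: "0 < q" and grows: "grows_at_least q"
  shows "orlicz_beta N \<le> 1 / q"
proof -
  obtain c where c: "0 < c" and gr: "\<And>w R. \<phi> 1 \<le> w \<Longrightarrow> (1::real) \<le> R \<Longrightarrow> c * R powr q * N w \<le> N (R * w)"
    using grows_at_least_from[OF grows, of "\<phi> 1"] q by auto
  have "1 / \<phi> (2 ^ j) \<le> (1 / c) powr (1 / q) * 2 powr (1 / q * real n) * (1 / \<phi> (2 ^ (j + n)))" for j n
  proof -
    define R where "R = \<phi> (2 ^ (j + n)) / \<phi> (2 ^ j)"
    have R: "1 \<le> R" using inv_dyadic_mono[of j "j + n"] by (simp add: R_def le_divide_eq)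
    have Rw: "R * \<phi> (2 ^ j) = \<phi> (2 ^ (j + n))" by (simp add: R_def less_imp_neq[symmetric])
    have "c * R powr q * 2 ^ j \<le> 2 ^ n * 2 ^ j"
      using gr[of "\<phi> (2 ^ j)" R] inv_dyadic_mono[of 0 j] R
      by (simp add: Rw power_add mult_ac)
    then have "c * R powr q \<le> 2 ^ n" by simp
    then have "R powr q \<le> 1 / c * 2 ^ n"
      using c by (simp add: field_simps)
    then have "(R powr q) powr (1 / q) \<le> (1 / c * 2 ^ n) powr (1 / q)"
      using q by (intro powr_mono2) auto
    also have "(1 / c * 2 ^ n) powr (1 / q) = (1 / c) powr (1 / q) * (2 ^ n) powr (1 / q)"
      using c by (simp only: powr_mult)
    also have "(2 ^ n) powr (1 / q) = 2 powr (1 / q * real n)"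
      by (simp add: powr_realpow[symmetric] powr_powr mult.commute)
    finally have "R \<le> (1 / c) powr (1 / q) * 2 powr (1 / q * real n)"
      using R q by (simp add: powr_powr)
    then show ?thesis
      by (simp add: R_def divide_simps mult_ac)
  qed
  then show ?thesis
    unfolding beta_eq using c
    by (intro dyadic_index_leI[OF bounded_ratios_inverse[OF bounded_ratios_inv], of "(1 / c) powr (1 / q)"])
      simp_all
qed

lemma le_alpha_if_grows_at_most:
  assumes q: "0 < q" and grows: "grows_at_most q"
  shows "1 / q \<le> orlicz_alpha N"
proof -
  obtain C where C: "0 < C" and gr: "\<And>w R. \<phi> 1 \<le> w \<Longrightarrow> (1::real) \<le> R \<Longrightarrow> N (R * w) \<le> C * R powr q * N w"
    using grows_at_most_from[OF grows, of "\<phi> 1"] q by auto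
  have "\<phi> (2 ^ j) \<le> C powr (1 / q) * 2 powr (- (1 / q) * real n) * \<phi> (2 ^ (j + n))" for j n
  proof -
    define R where "R = \<phi> (2 ^ (j + n)) / \<phi> (2 ^ j)"
    have R: "1 \<le> R" using inv_dyadic_mono[of j "j + n"] by (simp add: R_def le_divide_eq)
    have Rw: "R * \<phi> (2 ^ j) = \<phi> (2 ^ (j + n))" by (simp add: R_def less_imp_neq[symmetric])
    have "2 ^ n * 2 ^ j \<le> C * R powr q * 2 ^ j"
      using gr[of "\<phi> (2 ^ j)" R] inv_dyadic_mono[of 0 j] R
      by (simp add: Rw power_add mult_ac)
    then have "2 ^ n \<le> C * R powr q" by simp
    then have "(2 ^ n) powr (1 / q) \<le> (C * R powr q) powr (1 / q)"
      using q by (intro powr_mono2) auto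
    also have "(C * R powr q) powr (1 / q) = C powr (1 / q) * R"
      using C q R by (simp add: powr_mult powr_powr)
    also have "(2 ^ n) powr (1 / q) = 2 powr (1 / q * real n)"
      by (simp add: powr_realpow[symmetric] powr_powr mult.commute)
    finally have "2 powr (1 / q * real n) \<le> C powr (1 / q) * R" .
    then show ?thesis
      by (simp add: R_def divide_simps powr_minus mult_ac)
  qed
  then have "dyadic_index (\<lambda>j. \<phi> (2 ^ j)) \<le> - (1 / q)"
    using C by (intro dyadic_index_leI[OF bounded_ratios_inv, of "C powr (1 / q)"]) simp_all
  then show ?thesis
    by (simp add: alpha_eq)
qed

lemma beta_le_1: "orlicz_beta N \<le> 1"
proof -
  have "grows_at_least 1"
    unfolding grows_at_least_def using N_dilate
    by (intro exI[of _ 1] conjI) auto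
  then show ?thesis using beta_le_if_grows_at_least[of 1] by simp
qed

text \<open>
  The \<open>\<Delta>\<^sub>2\<close>-condition with constant \<open>C\<close> is growth along the progression \<open>2\<^sup>t\<close> with exponent
  \<open>log 2 C\<close>.
\<close>

lemma alpha_pos:
  assumes "Delta2_infinity N"
  shows "0 < orlicz_alpha N"
proof -
  obtain C where C: "\<And>u. 1 \<le> u \<Longrightarrow> N (2 * u) / N u \<le> C"
    using assms by (auto simp: Delta2_infinity_def bdd_above_def)
  have le: "N (2 * u) \<le> C * N u" if "1 \<le> u" for u
    using C[OF that] that by (simp add: divide_le_eq)
  have "1 < C"
  proof -
    have "1 * N 1 < N 2" using N_less[of 1 2] by simp
    also have "\<dots> \<le> C * N 1" using le[of 1] by simp
    finally show ?thesis by (simp only: mult_less_cancel_right_pos N_pos zero_less_one)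
  qed
  then have q: "0 < log 2 C" by simp
  have "grows_at_most (log 2 C)"
  proof (rule grows_at_mostI_geometric)
    fix t
    have "N (2 * 2 ^ t) \<le> C * N (2 ^ t)" by (rule le) simp
    then show "N (1 * 2 ^ Suc t) \<le> 2 powr log 2 C * N (1 * 2 ^ t)"
      using \<open>1 < C\<close> by simp
  qed (use q in auto)
  from le_alpha_if_grows_at_most[OF q this] q show ?thesis
    by (meson less_le_trans zero_less_divide_1_iff)
qed

text \<open>
  At any fixed argument the two ratios under the suprema are reciprocal, so the product of the
  suprema is at least \<open>1\<close>.
\<close>

lemma alpha_le_beta: "orlicz_alpha N \<le> orlicz_beta N"
proof -
  let ?c = "\<lambda>j. \<phi> (2 ^ j)"
  note c = bounded_ratios_inv and c' = bounded_ratios_inverse[OF bounded_ratios_inv]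
  have "(\<lambda>n. 1 / real n * log 2 (dyadic_sup ?c n) + 1 / real n * log 2 (dyadic_sup (\<lambda>j. 1 / ?c j) n))
      \<longlonglongrightarrow> dyadic_index ?c + dyadic_index (\<lambda>j. 1 / ?c j)"
    by (intro tendsto_add dyadic_index_LIMSEQ c c')
  moreover have "0 \<le> 1 / real n * log 2 (dyadic_sup ?c n) + 1 / real n * log 2 (dyadic_sup (\<lambda>j. 1 / ?c j) n)" for n
  proof -
    let ?S = "dyadic_sup ?c n" and ?T = "dyadic_sup (\<lambda>j. 1 / ?c j) n"
    have "?c 0 \<le> ?S * ?c n" "1 / ?c 0 \<le> ?T * (1 / ?c n)"
      using dyadic_sup_upper[OF c, of 0 n] dyadic_sup_upper[OF c', of 0 n] by simp_all
    then have "?c 0 * (1 / ?c 0) \<le> (?S * ?c n) * (?T * (1 / ?c n))"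
      by (intro mult_mono) (auto simp: dyadic_sup_pos[OF c] less_imp_le)
    then have "1 \<le> ?S * ?T"
      by (simp add: less_imp_neq[symmetric])
    then have "0 \<le> log 2 (?S * ?T)" by simp
    also have "\<dots> = log 2 ?S + log 2 ?T"
      by (intro log_mult_pos dyadic_sup_pos c c')
    finally show ?thesis by (simp add: add_divide_distrib[symmetric])
  qed
  ultimately have "0 \<le> dyadic_index ?c + dyadic_index (\<lambda>j. 1 / ?c j)"
    by (intro LIMSEQ_le_const) auto
  then show ?thesis by (simp add: alpha_eq beta_eq)
qed

end

section \<open>Approximating powers by sums of dilates\<close>

text \<open>
  The dichotomy behind the sufficiency of the interval. Suppose that on every interval far out the
  two end terms carry a fixed proportion of the whole sum. Enlarging an interval around \<open>i\<close> by one on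
  both sides then multiplies its sum by at least \<open>1 + \<epsilon>\<close>, so that the sum over radius \<open>r\<close> is at least
  \<open>(1 + \<epsilon>)\<^sup>r H i\<close>. As the two end terms carry a proportion \<open>\<epsilon>\<close> of it, there is a radius \<open>m\<close> with
  \<open>4 H i \<le> H (i - m) + H (i + m)\<close>. A positive sequence \<open>G\<close> with
  \<open>4 G (t + 1) \<le> G t + G (t + 2)\<close> that doubles once doubles ever after, and if it never doubles, then
  it always halves.
\<close>

lemma doubling_or_halving:
  fixes H :: "nat \<Rightarrow> real"
  assumes pos: "\<And>k. 0 < H k" and eps: "0 < \<epsilon>"
    and ends: "\<And>i j. \<Lambda> \<le> i \<Longrightarrow> i \<le> j \<Longrightarrow> \<epsilon> * (\<Sum>k=i..j. H k) \<le> H i + H j"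
  obtains m where "1 \<le> m"
    "(\<exists>i. \<forall>t. 2 * H (i + t * m) \<le> H (i + Suc t * m)) \<or>
     (\<exists>i. \<forall>t. 2 * H (i + Suc t * m) \<le> H (i + t * m))"
proof -
  have growth: "(1 + \<epsilon>) ^ r * H i \<le> (\<Sum>k=i-r..i+r. H k)" if "\<Lambda> + r \<le> i" for i r
    using that
  proof (induction r)
    case (Suc r)
    let ?S = "\<Sum>k=i-r..i+r. H k" and ?S' = "\<Sum>k=i-Suc r..i+Suc r. H k"
    have "i - r = Suc (i - Suc r)" using Suc.prems by simp
    then have "?S' = H (i - Suc r) + (?S + H (i + Suc r))"
      by (simp add: sum.atLeast_Suc_atMost[of "i - Suc r"])
    moreover have "\<epsilon> * ?S' \<le> H (i - Suc r) + H (i + Suc r)"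
      using Suc.prems by (intro ends) auto
    ultimately have S': "?S + \<epsilon> * ?S' \<le> ?S'" and "?S \<le> ?S'"
      using pos[of "i - Suc r"] pos[of "i + Suc r"] by linarith+
    then have "\<epsilon> * ?S \<le> \<epsilon> * ?S'" using eps by (intro mult_left_mono) auto
    then have "(1 + \<epsilon>) * ?S \<le> ?S'" using S' by (simp only: distrib_right mult_1)
    moreover have "(1 + \<epsilon>) * ((1 + \<epsilon>) ^ r * H i) \<le> (1 + \<epsilon>) * ?S"
      using Suc eps by (intro mult_left_mono) auto
    ultimately show ?case by (simp only: power_Suc mult.assoc)
  qed simp
  \<comment> \<open>the successor only ensures that the step \<open>m\<close> is positive\<close>
  obtain n where n: "4 / \<epsilon> < (1 + \<epsilon>) ^ n"
    using real_arch_pow[of "1 + \<epsilon>"] eps by auto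
  define m where "m = Suc n"
  have "(1 + \<epsilon>) ^ n \<le> (1 + \<epsilon>) ^ m"
    unfolding m_def using eps by (intro power_increasing) auto
  then have m: "4 \<le> \<epsilon> * (1 + \<epsilon>) ^ m"
    using less_le_trans[OF n] eps by (fastforce simp: divide_less_eq mult.commute)
  have four: "4 * H i \<le> H (i - m) + H (i + m)" if "\<Lambda> + m \<le> i" for i
  proof -
    have "4 * H i \<le> \<epsilon> * (1 + \<epsilon>) ^ m * H i"
      using m pos[of i] by (intro mult_right_mono) auto
    also have "\<dots> \<le> \<epsilon> * (\<Sum>k=i-m..i+m. H k)"
      using growth[OF that] eps by (simp add: mult.assoc mult_left_mono)
    also have "\<dots> \<le> H (i - m) + H (i + m)"
      using that by (intro ends) auto
    finally show ?thesis .
  qed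
  define G where "G t = H (\<Lambda> + t * m)" for t
  have G: "4 * G (Suc t) \<le> G t + G (Suc (Suc t))" for t
    using four[of "\<Lambda> + Suc t * m"] by (simp add: G_def add_ac)
  show ?thesis
  proof (cases "\<exists>t. 2 * G t \<le> G (Suc t)")
    case True
    then obtain t0 where t0: "2 * G t0 \<le> G (Suc t0)" by blast
    have "2 * G (t0 + t) \<le> G (Suc (t0 + t))" for t
    proof (induction t)
      case (Suc t)
      then show ?case using G[of "t0 + t"] pos[of "\<Lambda> + (t0 + t) * m"]
        by (simp add: G_def)
    qed (use t0 in simp)
    then have "\<forall>t. 2 * H (\<Lambda> + t0 * m + t * m) \<le> H (\<Lambda> + t0 * m + Suc t * m)"
      by (simp add: G_def algebra_simps)
    then show ?thesis using that[of m] by (auto simp: m_def)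
  next
    case False
    then have "2 * G (Suc t) \<le> G t" for t
      using G[of t] not_le[of "2 * G (Suc t)" "G (Suc (Suc t))"] by fastforce
    then have "\<forall>t. 2 * H (\<Lambda> + Suc t * m) \<le> H (\<Lambda> + t * m)"
      by (simp add: G_def)
    then show ?thesis using that[of m] by (auto simp: m_def)
  qed
qed

text \<open>
  Between two points of the geometric grid both functions are monotone, and the power changes by at most
  \<open>K - 1 \<le> \<delta> / 4\<close>. To the left of the last grid point both functions are small.
\<close>

lemma mono_close_to_power:
  fixes F :: "real \<Rightarrow> real"
  assumes mono: "\<And>x y. 0 \<le> x \<Longrightarrow> x \<le> y \<Longrightarrow> y \<le> 1 \<Longrightarrow> F x \<le> F y"
    and nonneg: "\<And>x. 0 \<le> x \<Longrightarrow> 0 \<le> F x"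
    and p: "0 < p" and D: "1 < D" and K: "K = D powr p" "K \<le> 1 + \<delta> / 4" "1 / K ^ L \<le> \<delta> / 4"
    and grid: "\<And>l. l \<le> L \<Longrightarrow> \<bar>F (1 / D ^ l) - 1 / K ^ l\<bar> \<le> \<delta> / 4"
    and s: "0 \<le> s" "s \<le> 1"
  shows "\<bar>F s - s powr p\<bar> \<le> \<delta>"
proof -
  have K1: "1 < K" using D p K(1) by simp
  have grid_powr: "(1 / D ^ l) powr p = 1 / K ^ l" for l
    using D by (simp add: K(1) powr_divide power_powr_swap)
  show ?thesis
  proof (cases "s \<le> 1 / D ^ L")
    case True
    have "F s \<le> F (1 / D ^ L)" using True s D by (intro mono) auto
    moreover have "s powr p \<le> (1 / D ^ L) powr p" using True s p by (intro powr_mono2) auto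
    moreover have "0 \<le> F s" "0 \<le> s powr p" using s nonneg by auto
    ultimately show ?thesis
      using grid[of L] K(3) unfolding grid_powr by linarith
  next
    case False
    have "0 < 1 / D ^ L" using D by simp
    then have s0: "0 < s" using False by linarith
    obtain l where l: "D ^ l \<le> 1 / s" "1 / s < D ^ Suc l"
      using geometric_bracket[OF D, of "1 / s"] s s0 by (auto simp: le_divide_eq)
    have lo: "1 / D ^ Suc l \<le> s" and hi: "s \<le> 1 / D ^ l"
      using l s0 D by (simp_all add: field_simps)
    have "D ^ l < D ^ L"
      using l(1) False s0 D by (smt (verit) divide_less_eq less_divide_eq mult.commute zero_less_power)
    then have lL: "Suc l \<le> L" using D by simp
    have "F s \<le> F (1 / D ^ l)" using hi s D by (intro mono) auto
    moreover have "F (1 / D ^ Suc l) \<le> F s" using lo s D by (intro mono) auto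
    moreover have "s powr p \<le> 1 / K ^ l"
      using powr_mono2[OF _ s(1) hi, of p] p grid_powr[of l] by simp
    moreover have "1 / K ^ Suc l \<le> s powr p"
      using powr_mono2[OF _ _ lo, of p] p D grid_powr[of "Suc l"] by simp
    moreover have "1 / K ^ l - 1 / K ^ Suc l \<le> \<delta> / 4"
    proof -
      have "1 / K ^ l - 1 / K ^ Suc l = (K - 1) / K ^ Suc l"
        using K1 by (simp add: field_simps)
      also have "\<dots> \<le> (K - 1) / 1"
        using K1 by (intro divide_left_mono one_le_power) auto
      finally show ?thesis using K(2) by simp
    qed
    moreover have "\<bar>F (1 / D ^ l) - 1 / K ^ l\<bar> \<le> \<delta> / 4" "\<bar>F (1 / D ^ Suc l) - 1 / K ^ Suc l\<bar> \<le> \<delta> / 4"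
      using grid[OF lL] grid[of l] lL by (simp_all del: power_Suc)
    ultimately show ?thesis by linarith
  qed
qed

text \<open>
  Shifting a window by \<open>l\<close> exchanges \<open>l\<close> terms next to each end. These are controlled by the end term
  itself, since \<open>H\<close> cannot drop by more than a factor \<open>K\<close> from one term to the next.
\<close>

lemma window_shift:
  fixes H :: "nat \<Rightarrow> real"
  assumes nonneg: "\<And>k. 0 \<le> H k" and K: "1 \<le> K"
    and lag: "\<And>k r. r \<le> k \<Longrightarrow> H (k - r) \<le> K ^ r * H k"
    and ij: "l \<le> i" "i \<le> j"
  shows "\<bar>(\<Sum>k=i..j. H (k - l)) - (\<Sum>k=i..j. H k)\<bar> \<le> real l * K ^ l * (H i + H j)"
proof -
  have tail: "(\<Sum>k=b-l..<b. H k) \<le> real l * K ^ l * H a" if "b \<le> Suc a" "a \<le> b" "l \<le> b" for a b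
  proof -
    have "H k \<le> K ^ l * H a" if "k \<in> {b - l..<b}" for k
    proof -
      have k: "k \<le> a" "a - k \<le> l" using that \<open>b \<le> Suc a\<close> \<open>a \<le> b\<close> by auto
      have "H k \<le> K ^ (a - k) * H a" using lag[of "a - k" a] k by simp
      also have "\<dots> \<le> K ^ l * H a"
        using K k nonneg by (intro mult_right_mono power_increasing) auto
      finally show ?thesis .
    qed
    then have "(\<Sum>k=b-l..<b. H k) \<le> real (card {b - l..<b}) * (K ^ l * H a)"
      by (intro sum_bounded_above) auto
    then show ?thesis using that by simp
  qed
  have shift: "(\<Sum>k=i..j. H (k - l)) = (\<Sum>k=i-l..<Suc j-l. H k)"
    using ij by (intro sum.reindex_bij_witness[of _ "\<lambda>k. k + l" "\<lambda>k. k - l"]) auto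
  have "(\<Sum>k=i-l..<Suc j-l. H k) + (\<Sum>k=Suc j-l..<Suc j. H k) = (\<Sum>k=i-l..<i. H k) + (\<Sum>k=i..<Suc j. H k)"
    using ij by (simp add: sum.atLeastLessThan_concat del: sum.op_ivl_Suc)
  moreover have "(\<Sum>k=i-l..<i. H k) \<le> real l * K ^ l * H i"
    using ij by (intro tail) auto
  moreover have "(\<Sum>k=Suc j-l..<Suc j. H k) \<le> real l * K ^ l * H j"
    using ij by (intro tail) auto
  moreover have "0 \<le> (\<Sum>k=i-l..<i. H k)" "0 \<le> (\<Sum>k=Suc j-l..<Suc j. H k)"
    using nonneg by (auto intro!: sum_nonneg simp del: sum.op_ivl_Suc)
  moreover have "0 \<le> real l * K ^ l * H i" "0 \<le> real l * K ^ l * H j"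
    using nonneg K by auto
  moreover have "(\<Sum>k=i..j. H k) = (\<Sum>k=i..<Suc j. H k)"
    by (simp add: atLeastLessThanSuc_atLeastAtMost)
  ultimately show ?thesis
    unfolding shift distrib_left by linarith
qed

context orlicz
begin

text \<open>
  Doubling of \<open>H\<close> along an arithmetic progression of step \<open>m\<close> means that \<open>N\<close> grows at least with exponent
  \<open>p + log E 2\<close>, where \<open>E = D\<^sup>m\<close>; halving means that it grows at most with exponent \<open>p - log E 2\<close>. Both
  are excluded, so the end terms of some window must be negligible.
\<close>

lemma flat_window:
  assumes least: "\<And>q. grows_at_least q \<Longrightarrow> q \<le> p"
    and most: "\<And>q. 0 < q \<Longrightarrow> grows_at_most q \<Longrightarrow> p \<le> q"
    and D: "1 < D" and p: "0 < p" and eps: "0 < \<epsilon>"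
  defines "H \<equiv> \<lambda>k. N (D ^ k) / (D powr p) ^ k"
  shows "\<exists>i\<ge>\<Lambda>. \<exists>j\<ge>i. H i + H j \<le> \<epsilon> * (\<Sum>k=i..j. H k)"
proof (rule ccontr)
  assume no: "\<not> ?thesis"
  have Hpos: "0 < H k" for k
    using D by (simp add: H_def)
  have "\<epsilon> * (\<Sum>k=i..j. H k) \<le> H i + H j" if "\<Lambda> \<le> i" "i \<le> j" for i j
    using that no by (meson linear)
  then obtain m where m: "1 \<le> m" and cases:
    "(\<exists>i. \<forall>t. 2 * H (i + t * m) \<le> H (i + Suc t * m)) \<or>
     (\<exists>i. \<forall>t. 2 * H (i + Suc t * m) \<le> H (i + t * m))"
    using doubling_or_halving[of H \<epsilon> \<Lambda>] Hpos eps by metis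
  define E where "E = D ^ m"
  have E: "1 < E" using D m by (simp add: E_def one_less_power)
  define K where "K = E powr p"
  have K0: "0 < K" using E by (simp add: K_def)
  have H_eq: "H (i + t * m) = N (D ^ i * E ^ t) / ((D powr p) ^ i * K ^ t)" for i t
    using D by (simp add: H_def K_def E_def power_add power_mult[symmetric] mult.commute power_powr_swap)
  have log2: "E powr log E 2 = 2" "0 < log E 2" using E by simp_all
  from cases show False
  proof
    assume "\<exists>i. \<forall>t. 2 * H (i + t * m) \<le> H (i + Suc t * m)"
    then obtain i where i: "\<And>t. 2 * H (i + t * m) \<le> H (i + Suc t * m)" by blast
    have "grows_at_least (p + log E 2)"
    proof (rule grows_at_leastI_geometric[OF E])
      show "0 < D ^ i" "0 \<le> p + log E 2" using D p log2 by auto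
      fix t
      show "E powr (p + log E 2) * N (D ^ i * E ^ t) \<le> N (D ^ i * E ^ Suc t)"
        using i[of t] D K0 unfolding H_eq powr_add log2 K_def[symmetric]
        by (simp add: divide_simps mult_ac split: if_splits)
    qed
    then show False using least log2 by fastforce
  next
    assume "\<exists>i. \<forall>t. 2 * H (i + Suc t * m) \<le> H (i + t * m)"
    then obtain i where i: "\<And>t. 2 * H (i + Suc t * m) \<le> H (i + t * m)" by blast
    have step: "N (D ^ i * E ^ Suc t) \<le> E powr (p - log E 2) * N (D ^ i * E ^ t)" for t
      using i[of t] D K0 unfolding H_eq powr_diff log2 K_def[symmetric]
      by (simp add: divide_simps mult_ac split: if_splits)
    \<comment> \<open>the exponent is positive because \<open>N\<close> is strictly increasing\<close>
    have "1 * N (D ^ i) < N (D ^ i * E)"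
      using D E by (simp add: N_less)
    also have "\<dots> \<le> E powr (p - log E 2) * N (D ^ i)"
      using step[of 0] by simp
    finally have "1 < E powr (p - log E 2)"
      using D by (simp only: mult_less_cancel_right_pos N_pos zero_less_power less_trans[OF zero_less_one])
    then have q: "0 < p - log E 2"
    proof (rule contrapos_pp)
      assume "\<not> 0 < p - log E 2"
      then have "E powr (p - log E 2) \<le> E powr 0" using E by (intro powr_mono) auto
      then show "\<not> 1 < E powr (p - log E 2)" using E by simp
    qed
    then have "grows_at_most (p - log E 2)"
      using D step by (intro grows_at_mostI_geometric[OF E, of "D ^ i"]) auto
    then show False using most q log2 by fastforce
  qed
qed

text \<open>
  The weights \<open>K\<^bsup>-k\<^esup>\<close>, normalised by the window sum \<open>W\<close> of \<open>H\<close>, turn dilation by \<open>D\<^bsup>-l\<^esup>\<close> into a shift of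
  the window by \<open>l\<close> together with the factor \<open>K\<^bsup>-l\<^esup> = D\<^bsup>-pl\<^esup>\<close>. A flat window is almost invariant under
  shifts by at most \<open>L\<close>, which gives the approximation on the grid \<open>D\<^bsup>-l\<^esup>\<close>. Taking the window far out
  makes the total weight small, because the weights times the large numbers \<open>N (D\<^sup>k)\<close> add up to \<open>1\<close>.
\<close>

proposition power_approximation:
  assumes least: "\<And>q. grows_at_least q \<Longrightarrow> q \<le> p"
    and most: "\<And>q. 0 < q \<Longrightarrow> grows_at_most q \<Longrightarrow> p \<le> q"
    and p: "0 < p" and \<delta>: "0 < \<delta>" and \<kappa>: "0 < \<kappa>"
  obtains J :: "nat set" and w v :: "nat \<Rightarrow> real"
  where "finite J" "\<And>j. j \<in> J \<Longrightarrow> 0 < w j" "\<And>j. j \<in> J \<Longrightarrow> 0 < v j" "sum w J \<le> \<kappa>"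
    "\<And>s. 0 \<le> s \<Longrightarrow> s \<le> 1 \<Longrightarrow> \<bar>(\<Sum>j\<in>J. w j * N (s * v j)) - s powr p\<bar> \<le> \<delta>"
proof -
  \<comment> \<open>a grid fine enough that the power changes by at most \<open>\<delta> / 4\<close> from one point to the next\<close>
  define K D where "K = 1 + \<delta> / 4" and "D = K powr (1 / p)"
  have K: "1 < K" using \<delta> by (simp add: K_def)
  have D: "1 < D" using K p by (simp add: D_def)
  have KD: "K = D powr p" using K p by (simp add: D_def powr_powr)
  obtain L0 where L0: "4 / \<delta> < K ^ L0" using real_arch_pow[OF K] by blast
  define L where "L = Suc L0"
  have "K ^ L0 \<le> K ^ L" using K by (intro power_increasing) (auto simp: L_def)
  then have "4 / \<delta> < K ^ L" using L0 by linarith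
  then have L: "1 / K ^ L \<le> \<delta> / 4" "1 \<le> L"
    using \<delta> K by (simp_all add: field_simps) (simp add: L_def)
  \<comment> \<open>shifting by at most \<open>L\<close> changes the window sum by at most \<open>L K\<^bsup>L\<^esup>\<close> times its end terms\<close>
  define \<epsilon> where "\<epsilon> = \<delta> / (4 * (real L * K ^ L))"
  have eps: "0 < \<epsilon>" using \<delta> L K by (simp add: \<epsilon>_def)
  obtain n where n: "\<phi> (1 / \<kappa>) < D ^ n" using real_arch_pow[OF D] by blast
  define H where "H k = N (D ^ k) / K ^ k" for k
  have Hpos: "0 < H k" for k using D K by (simp add: H_def)
  obtain i j where ij: "max L n \<le> i" "i \<le> j" and flat: "H i + H j \<le> \<epsilon> * (\<Sum>k=i..j. H k)"
    using flat_window[OF least most D p eps, of "max L n"] unfolding H_def KD by blast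
  define W where "W = (\<Sum>k=i..j. H k)"
  have W: "0 < W" unfolding W_def using ij Hpos by (intro sum_pos) auto
  define w where "w k = 1 / (W * K ^ k)" for k
  define F where "F s = (\<Sum>k=i..j. w k * N (s * D ^ k))" for s
  have wpos: "0 < w k" for k using W K by (simp add: w_def)
  have lag: "H (k - r) \<le> K ^ r * H k" if "r \<le> k" for k r
  proof -
    have "H (k - r) = K ^ r * (N (D ^ (k - r)) / K ^ k)"
      using that K by (simp add: H_def power_diff)
    also have "\<dots> \<le> K ^ r * H k"
      unfolding H_def using D K by (intro mult_left_mono divide_right_mono N_le power_increasing) auto
    finally show ?thesis .
  qed
  have grid: "\<bar>F (1 / D ^ l) - 1 / K ^ l\<bar> \<le> \<delta> / 4" if l: "l \<le> L" for l
  proof -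
    have "w k * N (1 / D ^ l * D ^ k) = H (k - l) / (W * K ^ l)" if "k \<in> {i..j}" for k
      using that l ij D K by (simp add: w_def H_def power_diff)
    then have "F (1 / D ^ l) = (\<Sum>k=i..j. H (k - l)) / (W * K ^ l)"
      by (simp add: F_def sum_divide_distrib)
    moreover have "1 / K ^ l = (\<Sum>k=i..j. H k) / (W * K ^ l)"
      using W by (simp add: W_def[symmetric])
    ultimately have "F (1 / D ^ l) - 1 / K ^ l = ((\<Sum>k=i..j. H (k - l)) - (\<Sum>k=i..j. H k)) / (W * K ^ l)"
      by (simp only: diff_divide_distrib)
    then have "\<bar>F (1 / D ^ l) - 1 / K ^ l\<bar> = \<bar>((\<Sum>k=i..j. H (k - l)) - (\<Sum>k=i..j. H k)) / (W * K ^ l)\<bar>"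
      by (rule arg_cong)
    also have "\<dots> = \<bar>(\<Sum>k=i..j. H (k - l)) - (\<Sum>k=i..j. H k)\<bar> / (W * K ^ l)"
      using W K by (subst abs_divide) simp
    also have "\<dots> \<le> real l * K ^ l * (H i + H j) / (W * K ^ l)"
    proof (intro divide_right_mono window_shift)
      show "0 \<le> H k" for k using Hpos by (rule less_imp_le)
      show "H (k - r) \<le> K ^ r * H k" if "r \<le> k" for k r using that by (rule lag)
    qed (use K l ij W in auto)
    also have "\<dots> = real l * (H i + H j) / W"
      using K by simp
    also have "\<dots> \<le> real L * K ^ L * (\<epsilon> * W) / W"
    proof (intro divide_right_mono)
      have "real l * (H i + H j) \<le> real L * (\<epsilon> * W)"
        using flat l Hpos[of i] Hpos[of j] by (intro mult_mono) (auto simp: W_def)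
      also have "\<dots> \<le> real L * (\<epsilon> * W) * K ^ L"
        using K eps W mult_left_mono[of 1 "K ^ L" "real L * (\<epsilon> * W)"] one_le_power[of K L] by simp
      finally show "real l * (H i + H j) \<le> real L * K ^ L * (\<epsilon> * W)"
        by (simp only: mult_ac)
    qed (use W in simp)
    also have "\<dots> = \<delta> / 4"
      using W K L by (simp add: \<epsilon>_def)
    finally show ?thesis .
  qed
  have Fmono: "F x \<le> F y" if "0 \<le> x" "x \<le> y" for x y
    unfolding F_def using that D
    by (intro sum_mono mult_left_mono N_le mult_right_mono) (auto intro: less_imp_le[OF wpos])
  have Fnn: "0 \<le> F x" if "0 \<le> x" for x
    unfolding F_def using that D by (intro sum_nonneg mult_nonneg_nonneg N_nonneg) (auto intro: less_imp_le[OF wpos])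
  show ?thesis
  proof (rule that[of "{i..j}" w "\<lambda>k. D ^ k"])
    show "0 < w k" "0 < D ^ k" for k using wpos D by auto
    have "w k \<le> \<kappa> * (H k / W)" if "k \<in> {i..j}" for k
    proof -
      have "D ^ n \<le> D ^ k" using that ij D by (intro power_increasing) auto
      then have "\<phi> (1 / \<kappa>) \<le> D ^ k" using n by linarith
      then have "1 / \<kappa> \<le> N (D ^ k)"
        using \<kappa> D by (subst (asm) inv_le_iff) auto
      then have "1 \<le> \<kappa> * N (D ^ k)" using \<kappa> by (simp add: field_simps)
      then have "1 / (W * K ^ k) \<le> \<kappa> * N (D ^ k) / (W * K ^ k)"
        using W K by (intro divide_right_mono) auto
      then show ?thesis by (simp add: w_def H_def mult.commute)
    qed
    then have "sum w {i..j} \<le> (\<Sum>k=i..j. \<kappa> * (H k / W))"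
      by (rule sum_mono)
    also have "\<dots> = \<kappa>"
      using W by (simp add: sum_distrib_left[symmetric] sum_divide_distrib[symmetric] W_def[symmetric])
    finally show "sum w {i..j} \<le> \<kappa>" .
    fix s :: real assume s: "0 \<le> s" "s \<le> 1"
    have "\<bar>F s - s powr p\<bar> \<le> \<delta>"
      using Fmono Fnn p D KD L(1) grid s
      by (intro mono_close_to_power[of F p D K \<delta> L]) (auto simp: K_def)
    then show "\<bar>(\<Sum>k=i..j. w k * N (s * D ^ k)) - s powr p\<bar> \<le> \<delta>"
      by (simp add: F_def)
  qed simp
qed

end

section \<open>Disjoint functions and the modular\<close>

text \<open>
  At every point at most one of several disjointly supported functions is nonzero. This makes
  integrals of \<open>N\<close> additive over them.
\<close>

lemma disjoint_sum_map:
  fixes y :: "'i \<Rightarrow> real" and g :: "real \<Rightarrow> 'b :: comm_monoid_add"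
  assumes "finite K" "g 0 = 0"
    and disj: "\<And>i j. i \<in> K \<Longrightarrow> j \<in> K \<Longrightarrow> i \<noteq> j \<Longrightarrow> y i = 0 \<or> y j = 0"
  shows "g (\<Sum>i\<in>K. y i) = (\<Sum>i\<in>K. g (y i))"
proof (cases "\<forall>i\<in>K. y i = 0")
  case True
  then show ?thesis using assms by simp
next
  case False
  then obtain k where k: "k \<in> K" "y k \<noteq> 0" by blast
  then have zero: "\<And>i. i \<in> K - {k} \<Longrightarrow> y i = 0" using disj by auto
  have "(\<Sum>i\<in>K. y i) = y k + (\<Sum>i\<in>K - {k}. y i)"
    "(\<Sum>i\<in>K. g (y i)) = g (y k) + (\<Sum>i\<in>K - {k}. g (y i))"
    using assms(1) k(1) by (rule sum.remove)+
  then show ?thesis using zero assms(2) by simp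
qed

lemma nn_integral_step:
  fixes g :: "real \<Rightarrow> ennreal"
  assumes "finite J" "g 0 = 0" and A: "\<And>j. j \<in> J \<Longrightarrow> A j \<in> sets M"
    and disj: "disjoint_family_on A J"
  shows "(\<integral>\<^sup>+t. g (\<Sum>j\<in>J. v j * indicator (A j) t) \<partial>M) = (\<Sum>j\<in>J. g (v j) * emeasure M (A j))"
proof -
  have "g (\<Sum>j\<in>J. v j * indicator (A j) t) = (\<Sum>j\<in>J. g (v j) * indicator (A j) t)" for t
  proof -
    have "v i * indicator (A i) t = 0 \<or> v j * indicator (A j) t = 0" if "i \<in> J" "j \<in> J" "i \<noteq> j" for i j
      using disj that by (auto simp: disjoint_family_on_def indicator_def)
    then have "g (\<Sum>j\<in>J. v j * indicator (A j) t) = (\<Sum>j\<in>J. g (v j * indicator (A j) t))"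
      using assms by (intro disjoint_sum_map) auto
    also have "\<dots> = (\<Sum>j\<in>J. g (v j) * indicator (A j) t)"
      using assms(2) by (intro sum.cong) (auto simp: indicator_def)
    finally show ?thesis .
  qed
  then have "(\<integral>\<^sup>+t. g (\<Sum>j\<in>J. v j * indicator (A j) t) \<partial>M) =
      (\<integral>\<^sup>+t. (\<Sum>j\<in>J. g (v j) * indicator (A j) t) \<partial>M)"
    by simp
  also have "\<dots> = (\<Sum>j\<in>J. \<integral>\<^sup>+t. g (v j) * indicator (A j) t \<partial>M)"
    using A by (intro nn_integral_sum) auto
  also have "\<dots> = (\<Sum>j\<in>J. g (v j) * emeasure M (A j))"
    using A by (intro sum.cong nn_integral_cmult_indicator) auto
  finally show ?thesis .
qed

text \<open>
  Consecutive intervals of the given lengths; the induction records that those placed so far fill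
  \<open>[0, sum w I)\<close>.
\<close>

lemma disjoint_sets_of_measure:
  fixes w :: "'i \<Rightarrow> real"
  assumes "finite I" "\<And>i. i \<in> I \<Longrightarrow> 0 \<le> w i" "sum w I \<le> 1"
  obtains A where "\<And>i. i \<in> I \<Longrightarrow> A i \<in> sets unit_leb"
    "\<And>i. i \<in> I \<Longrightarrow> emeasure unit_leb (A i) = ennreal (w i)" "disjoint_family_on A I"
proof -
  have "\<exists>A. (\<forall>i\<in>I. A i \<in> sets unit_leb \<and> A i \<subseteq> {0..<sum w I} \<and>
      emeasure unit_leb (A i) = ennreal (w i)) \<and> disjoint_family_on A I"
    using assms
  proof (induction I rule: finite_induct)
    case (insert x I)
    then have w: "0 \<le> w x" "sum w I + w x \<le> 1" "0 \<le> sum w I"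
      by (auto intro: sum_nonneg)
    then have "\<exists>A. (\<forall>i\<in>I. A i \<in> sets unit_leb \<and> A i \<subseteq> {0..<sum w I} \<and>
      emeasure unit_leb (A i) = ennreal (w i)) \<and> disjoint_family_on A I"
    proof (intro insert.IH)
      show "sum w I \<le> 1" using w by linarith
    qed (use insert.prems in simp)
    then obtain A where A: "\<And>i. i \<in> I \<Longrightarrow> A i \<in> sets unit_leb" "\<And>i. i \<in> I \<Longrightarrow> A i \<subseteq> {0..<sum w I}"
      "\<And>i. i \<in> I \<Longrightarrow> emeasure unit_leb (A i) = ennreal (w i)" "disjoint_family_on A I"
      by blast
    define B where "B = {sum w I..<sum w I + w x}"
    have Bsub: "B \<subseteq> {0..1}" using w by (auto simp: B_def)
    have "B \<in> sets lebesgue" by (simp add: B_def)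
    then have B: "B \<in> sets unit_leb" "emeasure unit_leb B = ennreal (w x)"
      using Bsub w by (auto simp: sets_restrict_space_iff emeasure_restrict_space B_def)
    have disj: "A i \<inter> B = {}" "B \<inter> A i = {}" if "i \<in> I" for i
      using A(2)[OF that] by (fastforce simp: B_def)+
    have "A i \<subseteq> {0..<sum w I + w x}" if "i \<in> I" for i
      using A(2)[OF that] w by fastforce
    moreover have "B \<subseteq> {0..<sum w I + w x}" using w by (auto simp: B_def)
    moreover have "disjoint_family_on (A(x := B)) (insert x I)"
      using A(4) disj insert.hyps by (simp add: disjoint_family_on_def)
    ultimately show ?case
      using insert.hyps A(1,3) B
      by (intro exI[of _ "A(x := B)"]) (simp add: add.commute fun_upd_def)
  qed (auto simp: disjoint_family_on_def)
  then show ?thesis using that by blast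
qed

lemma measurable_supp [measurable]:
  "x \<in> borel_measurable unit_leb \<Longrightarrow> supp x \<in> sets unit_leb"
proof -
  assume [measurable]: "x \<in> borel_measurable unit_leb"
  have "supp x = {t \<in> space unit_leb. x t \<noteq> 0}"
    by (simp add: supp_def)
  also have "\<dots> \<in> sets unit_leb" by measurable
  finally show ?thesis .
qed

lemma emeasure_unit_leb_le_1: "emeasure unit_leb A \<le> 1"
proof -
  have "emeasure unit_leb (space unit_leb) = 1"
    by (simp add: emeasure_restrict_space)
  then show ?thesis using emeasure_space[of unit_leb A] by simp
qed

text \<open>
  Equimeasurability compares the sets where \<open>\<bar>x\<bar> > \<tau>\<close> for \<open>\<tau> > 0\<close>; the support is their union as
  \<open>\<tau>\<close> decreases to \<open>0\<close>.
\<close>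

lemma equimeasurable_supp:
  assumes x: "x \<in> borel_measurable unit_leb" and y: "y \<in> borel_measurable unit_leb"
    and eq: "equimeasurable x y"
  shows "emeasure unit_leb (supp x) = emeasure unit_leb (supp y)"
proof -
  have lim: "(\<lambda>i. emeasure unit_leb {t \<in> {0..1}. \<bar>z t\<bar> > inverse (real (Suc i))})
      \<longlonglongrightarrow> emeasure unit_leb (supp z)" if [measurable]: "z \<in> borel_measurable unit_leb" for z
  proof -
    let ?A = "\<lambda>i. {t \<in> {0..1}. \<bar>z t\<bar> > inverse (real (Suc i))}"
    have "?A i = {t \<in> space unit_leb. \<bar>z t\<bar> > inverse (real (Suc i))}" for i
      by simp
    then have meas: "?A i \<in> sets unit_leb" for i
      by (simp only:) measurable
    have inc: "incseq ?A"
    proof (intro incseq_SucI subsetI)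
      fix i t assume t: "t \<in> ?A i"
      have "inverse (real (Suc (Suc i))) \<le> inverse (real (Suc i))"
        by (intro le_imp_inverse_le) auto
      moreover have "t \<in> {0..1}" "inverse (real (Suc i)) < \<bar>z t\<bar>" using t by blast+
      ultimately have "inverse (real (Suc (Suc i))) < \<bar>z t\<bar>" by linarith
      then show "t \<in> ?A (Suc i)" using \<open>t \<in> {0..1}\<close> by blast
    qed
    have "(\<Union>i. ?A i) = supp z"
    proof (intro equalityI subsetI)
      fix t assume "t \<in> supp z"
      then have "t \<in> {0..1}" "0 < \<bar>z t\<bar>" by (auto simp: supp_def)
      then show "t \<in> (\<Union>i. ?A i)" using reals_Archimedean[of "\<bar>z t\<bar>"] by auto
    next
      fix t assume "t \<in> (\<Union>i. ?A i)"
      then obtain i where "t \<in> {0..1}" "inverse (real (Suc i)) < \<bar>z t\<bar>" by auto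
      moreover have "0 < inverse (real (Suc i))" by simp
      ultimately show "t \<in> supp z" by (auto simp: supp_def)
    qed
    with Lim_emeasure_incseq[of ?A unit_leb] meas inc show ?thesis by auto
  qed
  have fin: "emeasure unit_leb A \<noteq> \<infinity>" for A
    using emeasure_unit_leb_le_1[of A] by (auto simp: top_unique)
  have "emeasure unit_leb {t \<in> {0..1}. \<bar>x t\<bar> > inverse (real (Suc i))} =
      emeasure unit_leb {t \<in> {0..1}. \<bar>y t\<bar> > inverse (real (Suc i))}" for i
    using eq fin by (simp add: equimeasurable_def emeasure_eq_ennreal_measure)
  then show ?thesis
    using lim[OF x] lim[OF y] by (simp add: LIMSEQ_unique)
qed

lemma supp_small:
  assumes n: "1 \<le> n" and meas: "\<And>k. k \<in> {1..n} \<Longrightarrow> x k \<in> borel_measurable unit_leb"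
    and eq: "\<And>i j. i \<in> {1..n} \<Longrightarrow> j \<in> {1..n} \<Longrightarrow> equimeasurable (x i) (x j)"
    and disj: "disjoint_family_on (\<lambda>k. supp (x k)) {1..n}" and k: "k \<in> {1..n}"
  shows "emeasure unit_leb (supp (x k)) \<le> ennreal (1 / real n)"
proof -
  let ?e = "emeasure unit_leb (supp (x k))"
  have "of_nat n * ?e = (\<Sum>i\<in>{1..n}. ?e)"
    by simp
  also have "\<dots> = (\<Sum>i\<in>{1..n}. emeasure unit_leb (supp (x i)))"
    using k by (intro sum.cong refl equimeasurable_supp meas eq)
  also have "\<dots> = emeasure unit_leb (\<Union>i\<in>{1..n}. supp (x i))"
    using meas disj by (intro sum_emeasure) auto
  also have "\<dots> \<le> 1"
    by (rule emeasure_unit_leb_le_1)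
  finally have le: "of_nat n * ?e \<le> 1" .
  have "?e = ennreal (1 / real n) * (of_nat n * ?e)"
    using n by (simp add: mult.assoc[symmetric] ennreal_of_nat_eq_real_of_nat ennreal_mult[symmetric])
  also have "\<dots> \<le> ennreal (1 / real n) * 1"
    using le by (rule mult_left_mono) simp
  finally show ?thesis by simp
qed

context orlicz
begin

lemma measurable_N_abs [measurable]:
  assumes [measurable]: "x \<in> borel_measurable M"
  shows "(\<lambda>t. N \<bar>x t\<bar>) \<in> borel_measurable M"
proof -
  have "continuous_on {0..} N" using orlicz by (simp add: orlicz_function_def)
  then have "continuous_on UNIV (\<lambda>y. N \<bar>y\<bar>)"
    by (rule continuous_on_compose2[of "{0..}" N UNIV abs]) (auto intro: continuous_intros)
  then have [measurable]: "(\<lambda>y. N \<bar>y\<bar>) \<in> borel_measurable borel"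
    by (rule borel_measurable_continuous_onI)
  show ?thesis by measurable
qed

text \<open>
  The modular as a function of a dilation \<open>s\<close> instead of the divisor \<open>u = 1 / s\<close> of the Luxemburg norm,
  since the growth of \<open>N\<close> is stated in terms of dilations.
\<close>

definition modular :: "(real \<Rightarrow> real) \<Rightarrow> real \<Rightarrow> ennreal" where
  "modular x s = (\<integral>\<^sup>+t. ennreal (N (s * \<bar>x t\<bar>)) \<partial>unit_leb)"

lemma measurable_N_dilate [measurable]:
  assumes "x \<in> borel_measurable M" "0 \<le> s"
  shows "(\<lambda>t. N (s * \<bar>x t\<bar>)) \<in> borel_measurable M"
proof -
  have "(\<lambda>t. N \<bar>s * x t\<bar>) \<in> borel_measurable M"
    using assms(1) by measurable
  then show ?thesis using assms(2) by (simp add: abs_mult)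
qed

lemma modular_0 [simp]: "modular x 0 = 0"
  by (simp add: modular_def)

lemma modular_mono: "0 \<le> s \<Longrightarrow> s \<le> s' \<Longrightarrow> modular x s \<le> modular x s'"
  unfolding modular_def
  by (intro nn_integral_mono ennreal_leI N_le mult_right_mono) auto

lemma luxemburg_norm_modular:
  "luxemburg_norm N x = (INF u\<in>{u. 0 < u \<and> modular x (1 / u) \<le> 1}. ennreal u)"
  by (simp add: luxemburg_norm_def modular_def)

lemma luxemburg_norm_leI: "0 < u \<Longrightarrow> modular x (1 / u) \<le> 1 \<Longrightarrow> luxemburg_norm N x \<le> ennreal u"
  unfolding luxemburg_norm_modular by (intro INF_lower) auto

lemma luxemburg_norm_geI:
  assumes "\<And>u. 0 < u \<Longrightarrow> u < b \<Longrightarrow> 1 < modular x (1 / u)"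
  shows "ennreal b \<le> luxemburg_norm N x"
  unfolding luxemburg_norm_modular
proof (rule INF_greatest)
  fix u assume "u \<in> {u. 0 < u \<and> modular x (1 / u) \<le> 1}"
  then have "0 < u" "\<not> 1 < modular x (1 / u)" by auto
  then have "b \<le> u" using assms[of u] by force
  then show "ennreal b \<le> ennreal u" by (rule ennreal_leI)
qed

lemma modular_le_1_if_luxemburg_norm_less:
  assumes "luxemburg_norm N x < ennreal u"
  shows "modular x (1 / u) \<le> 1"
proof -
  obtain u' where u': "0 < u'" "modular x (1 / u') \<le> 1" "ennreal u' < ennreal u"
    using assms unfolding luxemburg_norm_modular INF_less_iff by auto
  then have "u' < u" by (metis ennreal_less_iff less_imp_le)
  then have "modular x (1 / u) \<le> modular x (1 / u')"
    using u' by (intro modular_mono) (auto simp: frac_le)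
  then show ?thesis using u' by simp
qed

lemma modular_greater_1_if_less_luxemburg_norm:
  assumes "0 < u" "ennreal u < luxemburg_norm N x"
  shows "1 < modular x (1 / u)"
  using luxemburg_norm_leI[OF assms(1), of x] assms(2) by (auto simp: not_le[symmetric])

lemma modular_sum:
  assumes K: "finite K" and meas: "\<And>k. k \<in> K \<Longrightarrow> x k \<in> borel_measurable unit_leb"
    and disj: "disjoint_family_on (\<lambda>k. supp (x k)) K" and s: "0 \<le> s"
  shows "modular (\<lambda>t. \<Sum>k\<in>K. a k * x k t) s = (\<Sum>k\<in>K. modular (x k) (s * \<bar>a k\<bar>))"
proof -
  have "modular (\<lambda>t. \<Sum>k\<in>K. a k * x k t) s =
      (\<integral>\<^sup>+t. (\<Sum>k\<in>K. ennreal (N (s * \<bar>a k\<bar> * \<bar>x k t\<bar>))) \<partial>unit_leb)"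
    unfolding modular_def
  proof (rule nn_integral_cong)
    fix t assume "t \<in> space unit_leb"
    then have "a i * x i t = 0 \<or> a j * x j t = 0" if "i \<in> K" "j \<in> K" "i \<noteq> j" for i j
      using disj that by (auto simp: disjoint_family_on_def supp_def)
    then have "ennreal (N (s * \<bar>\<Sum>k\<in>K. a k * x k t\<bar>)) = (\<Sum>k\<in>K. ennreal (N (s * \<bar>a k * x k t\<bar>)))"
      using K by (intro disjoint_sum_map[where g = "\<lambda>y. ennreal (N (s * \<bar>y\<bar>))"]) auto
    then show "ennreal (N (s * \<bar>\<Sum>k\<in>K. a k * x k t\<bar>)) = (\<Sum>k\<in>K. ennreal (N (s * \<bar>a k\<bar> * \<bar>x k t\<bar>)))"
      by (simp add: abs_mult mult.assoc)
  qed
  also have "\<dots> = (\<Sum>k\<in>K. modular (x k) (s * \<bar>a k\<bar>))"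
    unfolding modular_def
  proof (rule nn_integral_sum)
    fix k assume "k \<in> K"
    then have "(\<lambda>t. N (s * \<bar>a k\<bar> * \<bar>x k t\<bar>)) \<in> borel_measurable unit_leb"
      using s by (intro measurable_N_dilate meas) auto
    then show "(\<lambda>t. ennreal (N (s * \<bar>a k\<bar> * \<bar>x k t\<bar>))) \<in> borel_measurable unit_leb"
      by simp
  qed
  finally show ?thesis .
qed

lemma modular_step:
  assumes J: "finite J" and A: "\<And>j. j \<in> J \<Longrightarrow> A j \<in> sets unit_leb"
    and w: "\<And>j. j \<in> J \<Longrightarrow> emeasure unit_leb (A j) = ennreal (w j)" "\<And>j. j \<in> J \<Longrightarrow> 0 \<le> w j"
    and disj: "disjoint_family_on A J" and v: "\<And>j. j \<in> J \<Longrightarrow> 0 \<le> v j" and s: "0 \<le> s"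
  shows "modular (\<lambda>t. \<Sum>j\<in>J. v j * indicator (A j) t) s = ennreal (\<Sum>j\<in>J. w j * N (s * v j))"
proof -
  have "modular (\<lambda>t. \<Sum>j\<in>J. v j * indicator (A j) t) s =
      (\<Sum>j\<in>J. ennreal (N (s * \<bar>v j\<bar>)) * emeasure unit_leb (A j))"
    unfolding modular_def using J A disj by (intro nn_integral_step) auto
  also have "\<dots> = (\<Sum>j\<in>J. ennreal (w j * N (s * v j)))"
    using v s w by (intro sum.cong) (auto simp: ennreal_mult mult.commute)
  also have "\<dots> = ennreal (\<Sum>j\<in>J. w j * N (s * v j))"
    using w v s by (intro sum_ennreal) auto
  finally show ?thesis .
qed

end

section \<open>Representation inside the interval\<close>

lemma ellp_norm_real:
  assumes "0 < p"
  shows "0 \<le> ellp_norm (ereal p) n a" "ellp_norm (ereal p) n a powr p = (\<Sum>k=1..n. \<bar>a k\<bar> powr p)"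
  using assms by (simp_all add: ellp_norm_def powr_powr sum_nonneg)

context orlicz
begin

text \<open>
  An additive approximation of \<open>s\<^sup>p\<close> becomes a multiplicative approximation of the norm. For \<open>a\<close> of norm
  \<open>1\<close> the modular differs from \<open>1\<close> by at most \<open>\<epsilon> / (1 + \<epsilon>)\<close>. Convexity, in the form \<open>r F s \<le> F (r s)\<close> for
  \<open>r \<ge> 1\<close>, then shows that a dilation by \<open>1 / (1 + \<epsilon>)\<close> brings it below \<open>1\<close> and a dilation by more than
  \<open>1 + \<epsilon>\<close> brings it above \<open>1\<close>.
\<close>

lemma luxemburg_norm_close_to_ellp_norm:
  fixes F :: "real \<Rightarrow> real" and a :: "nat \<Rightarrow> real"
  assumes p: "0 < p" and eps: "0 < \<epsilon>"
    and F_dilate: "\<And>r s. 1 \<le> r \<Longrightarrow> 0 \<le> s \<Longrightarrow> r * F s \<le> F (r * s)"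
    and close: "\<And>s. 0 \<le> s \<Longrightarrow> s \<le> 1 \<Longrightarrow> \<bar>F s - s powr p\<bar> \<le> \<epsilon> / (1 + \<epsilon>) / real n"
    and n: "1 \<le> n" and F0: "F 0 = 0"
    and mod: "\<And>s. 0 \<le> s \<Longrightarrow> modular y s = ennreal (\<Sum>k=1..n. F (s * \<bar>a k\<bar>))"
  shows "ennreal (ellp_norm (ereal p) n a / (1 + \<epsilon>)) \<le> luxemburg_norm N y"
    and "luxemburg_norm N y \<le> ennreal ((1 + \<epsilon>) * ellp_norm (ereal p) n a)"
proof -
  have "ennreal (ellp_norm (ereal p) n a / (1 + \<epsilon>)) \<le> luxemburg_norm N y \<and>
      luxemburg_norm N y \<le> ennreal ((1 + \<epsilon>) * ellp_norm (ereal p) n a)"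
  proof (cases "ellp_norm (ereal p) n a = 0")
    case True
    then have "(\<Sum>k=1..n. \<bar>a k\<bar> powr p) = 0" using ellp_norm_real(2)[OF p, of n a] by simp
    then have "\<forall>k\<in>{1..n}. a k = 0" by (subst (asm) sum_nonneg_eq_0_iff) auto
    then have mod0: "modular y s = 0" if "0 \<le> s" for s
      using mod[OF that] F0 by simp
    have "luxemburg_norm N y \<le> 0"
    proof (rule ennreal_le_epsilon)
      fix e :: real assume "0 < e"
      then have "luxemburg_norm N y \<le> ennreal e"
        by (intro luxemburg_norm_leI) (simp_all add: mod0)
      then show "luxemburg_norm N y \<le> 0 + ennreal e" by simp
    qed
    then show ?thesis using True by simp
  next
    case False
    define P where "P = ellp_norm (ereal p) n a"
    have P: "0 < P" using False ellp_norm_real(1)[OF p, of n a] by (simp add: P_def)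
    define b where "b k = \<bar>a k\<bar> / P" for k
    have sumb: "(\<Sum>k=1..n. b k powr p) = 1"
    proof -
      have "(\<Sum>k=1..n. b k powr p) = (\<Sum>k=1..n. \<bar>a k\<bar> powr p) / P powr p"
        using P by (simp add: b_def powr_divide sum_divide_distrib)
      also have "\<dots> = 1"
        using P by (simp only: ellp_norm_real(2)[OF p, of n a, folded P_def, symmetric]) simp
      finally show ?thesis .
    qed
    have b: "0 \<le> b k" for k using P by (simp add: b_def)
    have b1: "b k \<le> 1" if "k \<in> {1..n}" for k
    proof (rule ccontr)
      assume "\<not> b k \<le> 1"
      then have "1 powr p < b k powr p" using p by (intro powr_less_mono2) auto
      moreover have "b k powr p \<le> (\<Sum>k=1..n. b k powr p)"
        using that by (intro member_le_sum) auto
      ultimately show False using sumb by simp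
    qed
    have "\<bar>(\<Sum>k=1..n. F (b k)) - 1\<bar> = \<bar>\<Sum>k=1..n. F (b k) - b k powr p\<bar>"
      by (simp only: sum_subtractf sumb)
    also have "\<dots> \<le> (\<Sum>k=1..n. \<bar>F (b k) - b k powr p\<bar>)" by (rule sum_abs)
    also have "\<dots> \<le> (\<Sum>k=1..n. \<epsilon> / (1 + \<epsilon>) / real n)"
      using close b b1 by (intro sum_mono) auto
    also have "\<dots> = \<epsilon> / (1 + \<epsilon>)" using n by simp
    finally have sumF: "\<bar>(\<Sum>k=1..n. F (b k)) - 1\<bar> \<le> \<epsilon> / (1 + \<epsilon>)" .
    have "ennreal (P / (1 + \<epsilon>)) \<le> luxemburg_norm N y"
    proof (rule luxemburg_norm_geI)
      fix u assume u: "0 < u" "u < P / (1 + \<epsilon>)"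
      define r where "r = P / u"
      have r: "1 + \<epsilon> < r" using u eps by (simp add: r_def field_simps)
      have "1 < r * (1 - \<epsilon> / (1 + \<epsilon>))" using r eps by (simp add: field_simps)
      also have "\<dots> \<le> r * (\<Sum>k=1..n. F (b k))"
        using sumF r eps by (intro mult_left_mono) auto
      also have "\<dots> \<le> (\<Sum>k=1..n. F (r * b k))"
        unfolding sum_distrib_left using b r eps by (intro sum_mono F_dilate) auto
      also have "\<dots> = (\<Sum>k=1..n. F (1 / u * \<bar>a k\<bar>))"
        using P u by (simp add: r_def b_def)
      finally have "ennreal 1 < ennreal (\<Sum>k=1..n. F (1 / u * \<bar>a k\<bar>))"
        by (intro ennreal_lessI) auto
      then show "1 < modular y (1 / u)"
        using u by (simp add: mod)
    qed
    moreover have "luxemburg_norm N y \<le> ennreal ((1 + \<epsilon>) * P)"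
    proof (rule luxemburg_norm_leI)
      show u: "0 < (1 + \<epsilon>) * P" using P eps by simp
      have "(1 + \<epsilon>) * F (1 / ((1 + \<epsilon>) * P) * \<bar>a k\<bar>) \<le> F (b k)" for k
        using F_dilate[of "1 + \<epsilon>" "1 / ((1 + \<epsilon>) * P) * \<bar>a k\<bar>"] u P eps by (simp add: b_def)
      then have "(1 + \<epsilon>) * (\<Sum>k=1..n. F (1 / ((1 + \<epsilon>) * P) * \<bar>a k\<bar>)) \<le> (\<Sum>k=1..n. F (b k))"
        unfolding sum_distrib_left by (intro sum_mono) auto
      also have "\<dots> \<le> 1 + \<epsilon> / (1 + \<epsilon>)" using sumF by linarith
      also have "\<dots> \<le> 1 + \<epsilon>" using eps by (simp add: divide_le_eq)
      finally have "(\<Sum>k=1..n. F (1 / ((1 + \<epsilon>) * P) * \<bar>a k\<bar>)) \<le> 1" using eps by simp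
      then show "modular y (1 / ((1 + \<epsilon>) * P)) \<le> 1"
        using u by (subst mod) (auto simp: ennreal_le_1)
    qed
    ultimately show ?thesis by (simp add: P_def)
  qed
  then show "ennreal (ellp_norm (ereal p) n a / (1 + \<epsilon>)) \<le> luxemburg_norm N y"
    and "luxemburg_norm N y \<le> ennreal ((1 + \<epsilon>) * ellp_norm (ereal p) n a)"
    by auto
qed

text \<open>
  The approximating sum is the modular of a step function with value \<open>v j\<close> on a set of measure \<open>w j\<close>.
  Total weight at most \<open>1 / n\<close> leaves room for \<open>n\<close> disjoint copies.
\<close>

lemma sym_finitely_represented_if_approximable:
  assumes p: "0 < p"
    and approx: "\<And>\<delta> \<kappa>. 0 < \<delta> \<Longrightarrow> 0 < \<kappa> \<Longrightarrow>
      \<exists>(J :: nat set) w v. finite J \<and> (\<forall>j\<in>J. 0 < w j \<and> 0 < v j) \<and> sum w J \<le> \<kappa> \<and>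
        (\<forall>s. 0 \<le> s \<longrightarrow> s \<le> 1 \<longrightarrow> \<bar>(\<Sum>j\<in>J. w j * N (s * v j)) - s powr p\<bar> \<le> \<delta>)"
  shows "sym_finitely_represented (ereal p) (orlicz_space N) (luxemburg_norm N)"
  unfolding sym_finitely_represented_def
proof (intro allI impI)
  fix n :: nat and \<epsilon> :: real
  assume n: "1 \<le> n" and eps: "0 < \<epsilon>"
  define \<delta> where "\<delta> = \<epsilon> / (1 + \<epsilon>) / real n"
  have \<delta>: "0 < \<delta>" "real n * \<delta> = \<epsilon> / (1 + \<epsilon>)" using n eps by (auto simp: \<delta>_def)
  obtain J :: "nat set" and w v where J: "finite J"
    and wv: "\<And>j. j \<in> J \<Longrightarrow> 0 < w j" "\<And>j. j \<in> J \<Longrightarrow> 0 < v j" and sumw: "sum w J \<le> 1 / real n"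
    and close: "\<And>s. 0 \<le> s \<Longrightarrow> s \<le> 1 \<Longrightarrow> \<bar>(\<Sum>j\<in>J. w j * N (s * v j)) - s powr p\<bar> \<le> \<delta>"
    using approx[of \<delta> "1 / real n"] \<delta> n by auto
  define F where "F s = (\<Sum>j\<in>J. w j * N (s * v j))" for s
  have F0: "F 0 = 0" by (simp add: F_def)
  have Fnn: "0 \<le> F s" if "0 \<le> s" for s
    unfolding F_def using wv that by (intro sum_nonneg mult_nonneg_nonneg N_nonneg) (auto intro: less_imp_le)
  have F_dilate: "r * F s \<le> F (r * s)" if "1 \<le> r" "0 \<le> s" for r s
    unfolding F_def sum_distrib_left
  proof (rule sum_mono)
    fix j assume j: "j \<in> J"
    have "w j * (r * N (s * v j)) \<le> w j * N (r * (s * v j))"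
      using wv[OF j] that by (intro mult_left_mono N_dilate) (auto intro: less_imp_le)
    then show "r * (w j * N (s * v j)) \<le> w j * N (r * s * v j)" by (simp add: mult_ac)
  qed
  have sumI: "(\<Sum>i\<in>{1..n} \<times> J. w (snd i)) = real n * sum w J"
    using sum.cartesian_product[of "\<lambda>_. w" J "{1..n}"] by (simp add: case_prod_unfold)
  have "real n * sum w J \<le> real n * (1 / real n)" using sumw by (intro mult_left_mono) auto
  then have "(\<Sum>i\<in>{1..n} \<times> J. w (snd i)) \<le> 1" using n sumI by simp
  then obtain A where A: "\<And>i. i \<in> {1..n} \<times> J \<Longrightarrow> A i \<in> sets unit_leb"
    "\<And>i. i \<in> {1..n} \<times> J \<Longrightarrow> emeasure unit_leb (A i) = ennreal (w (snd i))"
    "disjoint_family_on A ({1..n} \<times> J)"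
    using disjoint_sets_of_measure[of "{1..n} \<times> J" "\<lambda>i. w (snd i)"] J wv by (force intro: less_imp_le)
  have Adisj: "disjoint_family_on (\<lambda>j. A (k, j)) J" if "k \<in> {1..n}" for k
    using A(3) that by (auto simp: disjoint_family_on_def)
  define x where "x k t = (\<Sum>j\<in>J. v j * indicator (A (k, j)) t)" for k t
  have meas: "x k \<in> borel_measurable unit_leb" if "k \<in> {1..n}" for k
    unfolding x_def using A(1) that by (intro borel_measurable_sum borel_measurable_times) auto
  have mod: "modular (x k) s = ennreal (F s)" if "k \<in> {1..n}" "0 \<le> s" for k s
    unfolding x_def F_def using that A wv J Adisj[OF that(1)]
    by (intro modular_step) (auto intro: less_imp_le)
  have level: "emeasure unit_leb {t \<in> {0..1}. \<tau> < \<bar>x k t\<bar>} = (\<Sum>j\<in>J. (if \<tau> < \<bar>v j\<bar> then 1 else 0) * ennreal (w j))"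
    if k: "k \<in> {1..n}" and tau: "0 < \<tau>" for k \<tau>
  proof -
    have xk [measurable]: "x k \<in> borel_measurable unit_leb" using k by (rule meas)
    have "{t \<in> space unit_leb. \<tau> < \<bar>x k t\<bar>} \<in> sets unit_leb" by measurable
    then have "emeasure unit_leb {t \<in> {0..1}. \<tau> < \<bar>x k t\<bar>} = (\<integral>\<^sup>+t. indicator {t \<in> {0..1}. \<tau> < \<bar>x k t\<bar>} t \<partial>unit_leb)"
      by simp
    also have "\<dots> = (\<integral>\<^sup>+t. (if \<tau> < \<bar>x k t\<bar> then 1 else 0) \<partial>unit_leb)"
      by (intro nn_integral_cong) (auto simp: indicator_def)
    also have "\<dots> = (\<Sum>j\<in>J. (if \<tau> < \<bar>v j\<bar> then 1 else 0) * emeasure unit_leb (A (k, j)))"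
      unfolding x_def using J A(1) k tau Adisj[OF k]
      by (intro nn_integral_step[where g = "\<lambda>y. if \<tau> < \<bar>y\<bar> then 1 else 0"]) auto
    also have "\<dots> = (\<Sum>j\<in>J. (if \<tau> < \<bar>v j\<bar> then 1 else 0) * ennreal (w j))"
      using A(2) k by (intro sum.cong) auto
    finally show ?thesis .
  qed
  have equi: "equimeasurable (x i) (x j)" if "i \<in> {1..n}" "j \<in> {1..n}" for i j
    using level that by (simp add: equimeasurable_def measure_def)
  have disj: "disjoint_family_on (\<lambda>k. supp (x k)) {1..n}"
  proof -
    have sub: "supp (x k) \<subseteq> (\<Union>j\<in>J. A (k, j))" for k
    proof
      fix t assume "t \<in> supp (x k)"
      then have "(\<Sum>j\<in>J. v j * indicator (A (k, j)) t) \<noteq> 0" by (simp add: supp_def x_def)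
      then obtain j where "j \<in> J" "v j * indicator (A (k, j)) t \<noteq> 0"
        by (meson sum.neutral)
      then show "t \<in> (\<Union>j\<in>J. A (k, j))" by (auto simp: indicator_def split: if_splits)
    qed
    have "(\<Union>j\<in>J. A (k, j)) \<inter> (\<Union>j\<in>J. A (l, j)) = {}"
      if "k \<in> {1..n}" "l \<in> {1..n}" "k \<noteq> l" for k l
    proof -
      have "A (k, j) \<inter> A (l, j') = {}" if "j \<in> J" "j' \<in> J" for j j'
        using disjoint_family_onD[OF A(3), of "(k, j)" "(l, j')"] that \<open>k \<in> _\<close> \<open>l \<in> _\<close> \<open>k \<noteq> l\<close>
        by simp
      then show ?thesis by blast
    qed
    then show ?thesis
      using Int_mono[OF sub sub] unfolding disjoint_family_on_def by (metis subset_empty)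
  qed
  have combo: "modular (\<lambda>t. \<Sum>k=1..n. a k * x k t) s = ennreal (\<Sum>k=1..n. F (s * \<bar>a k\<bar>))"
    if "0 \<le> s" for a s
  proof -
    have "modular (\<lambda>t. \<Sum>k=1..n. a k * x k t) s = (\<Sum>k=1..n. modular (x k) (s * \<bar>a k\<bar>))"
      using meas disj that by (intro modular_sum) auto
    also have "\<dots> = (\<Sum>k=1..n. ennreal (F (s * \<bar>a k\<bar>)))"
      using that by (intro sum.cong mod) auto
    also have "\<dots> = ennreal (\<Sum>k=1..n. F (s * \<bar>a k\<bar>))"
      using that Fnn by (intro sum_ennreal) auto
    finally show ?thesis .
  qed
  have norm: "ennreal (ellp_norm (ereal p) n a / (1 + \<epsilon>)) \<le> luxemburg_norm N (\<lambda>t. \<Sum>k=1..n. a k * x k t)"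
      "luxemburg_norm N (\<lambda>t. \<Sum>k=1..n. a k * x k t) \<le> ennreal ((1 + \<epsilon>) * ellp_norm (ereal p) n a)" for a
    by (rule luxemburg_norm_close_to_ellp_norm[OF p eps F_dilate, of n];
        use n F0 close combo in \<open>simp add: F_def \<delta>_def\<close>)+
  have "x k \<in> orlicz_space N" if k: "k \<in> {1..n}" for k
  proof -
    have "(\<lambda>t. \<Sum>i=1..n. (if i = k then 1 else 0) * x i t) = x k"
      using k by (simp add: if_distrib[of "\<lambda>c. c * _"] sum.delta cong: if_cong)
    then have "luxemburg_norm N (x k) < \<infinity>"
      using norm(2)[of "\<lambda>i. if i = k then 1 else 0"] by (auto intro: le_less_trans)
    then show ?thesis using meas[OF k] by (simp add: orlicz_space_def)
  qed
  then show "\<exists>x. (\<forall>k\<in>{1..n}. x k \<in> orlicz_space N) \<and>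
      (\<forall>i\<in>{1..n}. \<forall>j\<in>{1..n}. equimeasurable (x i) (x j)) \<and>
      disjoint_family_on (\<lambda>k. supp (x k)) {1..n} \<and>
      (\<forall>a. ennreal (ellp_norm (ereal p) n a / (1 + \<epsilon>)) \<le> luxemburg_norm N (\<lambda>t. \<Sum>k=1..n. a k * x k t) \<and>
        luxemburg_norm N (\<lambda>t. \<Sum>k=1..n. a k * x k t) \<le> ennreal ((1 + \<epsilon>) * ellp_norm (ereal p) n a))"
    using equi disj norm by blast
qed

end

section \<open>No representation outside the interval\<close>

text \<open>
  The formula covers \<open>p = \<infinity>\<close>: there \<open>real_of_ereal p = 0\<close>, the exponent \<open>1 / 0\<close> is \<open>0\<close>, and the value
  is \<open>1\<close>.
\<close>

lemma ellp_norm_indicator: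
  assumes "1 \<le> p" "B \<subseteq> {1..n}" "B \<noteq> {}"
  shows "ellp_norm p n (indicator B) = real (card B) powr (1 / real_of_ereal p)"
proof (cases "p = \<infinity>")
  case True
  have "Max ((\<lambda>k. \<bar>indicator B k\<bar> :: real) ` {1..n}) = 1"
    using assms(2,3) by (intro Max_eqI) (auto simp: indicator_def image_iff)
  moreover have "card B \<noteq> 0" using assms(2,3) finite_subset[of B "{1..n}"] by auto
  ultimately show ?thesis using True by (simp add: ellp_norm_def)
next
  case False
  have "(\<Sum>k=1..n. \<bar>indicator B k\<bar> powr real_of_ereal p) = (\<Sum>k\<in>{1..n}. indicator B k :: real)"
    by (intro sum.cong) (auto simp: indicator_def)
  also have "\<dots> = (\<Sum>k\<in>B. 1)"
    using assms(2) by (intro sum.mono_neutral_cong_right) (auto simp: indicator_def)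
  finally show ?thesis using False by (simp add: ellp_norm_def)
qed

context orlicz
begin

text \<open>
  Only sums of some of the functions \<open>x\<^sub>k\<close> are tested, up to the factor \<open>1 + \<epsilon> = 2\<close>. The factor \<open>3\<close>
  leaves a gap between the norm and the divisor, so that the modular lies on a definite side of \<open>1\<close>.
\<close>

lemma sym_finitely_represented_modular:
  assumes rep: "sym_finitely_represented p (orlicz_space N) (luxemburg_norm N)"
    and p: "1 \<le> p" and n: "1 \<le> n"
  obtains x where "\<And>k. k \<in> {1..n} \<Longrightarrow> x k \<in> borel_measurable unit_leb"
    "\<And>k. k \<in> {1..n} \<Longrightarrow> emeasure unit_leb (supp (x k)) \<le> ennreal (1 / real n)"
    "\<And>B. B \<subseteq> {1..n} \<Longrightarrow> B \<noteq> {} \<Longrightarrow>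
      (\<Sum>k\<in>B. modular (x k) (1 / (3 * real (card B) powr (1 / real_of_ereal p)))) \<le> 1"
    "\<And>B. B \<subseteq> {1..n} \<Longrightarrow> B \<noteq> {} \<Longrightarrow>
      1 \<le> (\<Sum>k\<in>B. modular (x k) (3 / real (card B) powr (1 / real_of_ereal p)))"
proof -
  obtain x where *: "(\<forall>k\<in>{1..n}. x k \<in> orlicz_space N) \<and>
      (\<forall>i\<in>{1..n}. \<forall>j\<in>{1..n}. equimeasurable (x i) (x j)) \<and>
      disjoint_family_on (\<lambda>k. supp (x k)) {1..n} \<and>
      (\<forall>a. ennreal (ellp_norm p n a / (1 + 1)) \<le> luxemburg_norm N (\<lambda>t. \<Sum>k=1..n. a k * x k t) \<and>
        luxemburg_norm N (\<lambda>t. \<Sum>k=1..n. a k * x k t) \<le> ennreal ((1 + 1) * ellp_norm p n a))"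
    using rep[unfolded sym_finitely_represented_def, rule_format, OF n zero_less_one] by (rule exE)
  then have x: "\<And>k. k \<in> {1..n} \<Longrightarrow> x k \<in> orlicz_space N"
    and eq: "\<And>i j. i \<in> {1..n} \<Longrightarrow> j \<in> {1..n} \<Longrightarrow> equimeasurable (x i) (x j)"
    and disj: "disjoint_family_on (\<lambda>k. supp (x k)) {1..n}"
    and norm: "\<And>a. ennreal (ellp_norm p n a / (1 + 1)) \<le> luxemburg_norm N (\<lambda>t. \<Sum>k=1..n. a k * x k t)"
      "\<And>a. luxemburg_norm N (\<lambda>t. \<Sum>k=1..n. a k * x k t) \<le> ennreal ((1 + 1) * ellp_norm p n a)"
    by blast+
  have meas: "x k \<in> borel_measurable unit_leb" if "k \<in> {1..n}" for k
    using x[OF that] by (simp add: orlicz_space_def)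
  have mod: "modular (\<lambda>t. \<Sum>k=1..n. indicator B k * x k t) s = (\<Sum>k\<in>B. modular (x k) s)"
    if "0 \<le> s" "B \<subseteq> {1..n}" for s B
  proof -
    have "modular (\<lambda>t. \<Sum>k=1..n. indicator B k * x k t) s = (\<Sum>k=1..n. modular (x k) (s * \<bar>indicator B k\<bar>))"
      using meas disj that by (intro modular_sum) auto
    also have "\<dots> = (\<Sum>k\<in>B. modular (x k) (s * \<bar>indicator B k\<bar>))"
      using that(2) by (intro sum.mono_neutral_right) auto
    also have "\<dots> = (\<Sum>k\<in>B. modular (x k) s)"
      by (intro sum.cong) auto
    finally show ?thesis .
  qed
  show ?thesis
  proof (rule that[of x])
    show "emeasure unit_leb (supp (x k)) \<le> ennreal (1 / real n)" if "k \<in> {1..n}" for k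
      using n meas eq disj that by (rule supp_small)
    fix B assume B: "B \<subseteq> {1..n}" "B \<noteq> {}"
    define b where "b = real (card B) powr (1 / real_of_ereal p)"
    have "card B \<noteq> 0" using B finite_subset[of B "{1..n}"] by auto
    then have b: "0 < b" by (simp add: b_def)
    have "luxemburg_norm N (\<lambda>t. \<Sum>k=1..n. indicator B k * x k t) \<le> ennreal (2 * b)"
      using norm(2)[of "indicator B"] by (simp add: ellp_norm_indicator[OF p B] b_def)
    also have "\<dots> < ennreal (3 * b)" using b by (intro ennreal_lessI) auto
    finally have "modular (\<lambda>t. \<Sum>k=1..n. indicator B k * x k t) (1 / (3 * b)) \<le> 1"
      by (rule modular_le_1_if_luxemburg_norm_less)
    then show "(\<Sum>k\<in>B. modular (x k) (1 / (3 * real (card B) powr (1 / real_of_ereal p)))) \<le> 1"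
      using b B(1) mod[of "1 / (3 * b)" B] by (simp add: b_def)
    have "ennreal (b / 3) < ennreal (b / 2)" using b by (intro ennreal_lessI) auto
    also have "\<dots> \<le> luxemburg_norm N (\<lambda>t. \<Sum>k=1..n. indicator B k * x k t)"
      using norm(1)[of "indicator B"] by (simp add: ellp_norm_indicator[OF p B] b_def)
    finally have "1 < modular (\<lambda>t. \<Sum>k=1..n. indicator B k * x k t) (1 / (b / 3))"
      using b by (intro modular_greater_1_if_less_luxemburg_norm) auto
    then show "1 \<le> (\<Sum>k\<in>B. modular (x k) (3 / real (card B) powr (1 / real_of_ereal p)))"
      using b B(1) mod[of "3 / b" B] by (simp add: b_def)
  qed (rule meas)
qed

text \<open>
  A comparison of \<open>N (s v)\<close> with \<open>N (s' v)\<close> that holds up to an additive constant integrates to one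
  in which the constant is multiplied by the measure of the support.
\<close>

lemma modular_compare:
  assumes x: "x \<in> borel_measurable unit_leb"
    and s: "0 \<le> s" "0 \<le> s'" and CD: "0 \<le> C" "0 \<le> D"
    and le: "\<And>v. 0 < v \<Longrightarrow> N (s * v) \<le> C * N (s' * v) + D"
  shows "modular x s \<le> ennreal C * modular x s' + ennreal D * emeasure unit_leb (supp x)"
proof -
  have "N (s * \<bar>x t\<bar>) \<le> C * N (s' * \<bar>x t\<bar>) + D * indicator (supp x) t" if "t \<in> {0..1}" for t
    using le[of "\<bar>x t\<bar>"] that by (cases "x t = 0") (auto simp: supp_def)
  then have "ennreal (N (s * \<bar>x t\<bar>)) \<le> ennreal C * ennreal (N (s' * \<bar>x t\<bar>)) + ennreal D * indicator (supp x) t"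
    if "t \<in> space unit_leb" for t
    using that CD s
    by (auto simp: ennreal_mult[symmetric] ennreal_indicator[symmetric] ennreal_plus[symmetric]
        simp del: ennreal_plus intro!: ennreal_leI)
  then have "modular x s \<le>
      (\<integral>\<^sup>+t. ennreal C * ennreal (N (s' * \<bar>x t\<bar>)) + ennreal D * indicator (supp x) t \<partial>unit_leb)"
    unfolding modular_def by (rule nn_integral_mono)
  also have "\<dots> = ennreal C * modular x s' + ennreal D * emeasure unit_leb (supp x)"
  proof -
    have [measurable]: "(\<lambda>t. N (s' * \<bar>x t\<bar>)) \<in> borel_measurable unit_leb" "supp x \<in> sets unit_leb"
      using x s by (auto intro: measurable_N_dilate measurable_supp)
    show ?thesis
      by (simp add: modular_def nn_integral_add nn_integral_cmult nn_integral_cmult_indicator)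
  qed
  finally show ?thesis .
qed

text \<open>
  With supports of measure at most \<open>1 / n\<close> the additive constants of a fixed number of functions
  contribute \<open>O(1 / n)\<close>, which disappears as \<open>n \<rightarrow> \<infinity>\<close>.
\<close>

lemma modular_sum_compare:
  assumes n: "1 \<le> n" "finite B" and x: "\<And>k. k \<in> B \<Longrightarrow> x k \<in> borel_measurable unit_leb"
    and small: "\<And>k. k \<in> B \<Longrightarrow> emeasure unit_leb (supp (x k)) \<le> ennreal (1 / real n)"
    and s: "0 \<le> s" "0 \<le> s'" and CD: "0 \<le> C" "0 \<le> D" and T: "0 \<le> T'"
    and le: "\<And>v. 0 < v \<Longrightarrow> N (s * v) \<le> C * N (s' * v) + D"
    and lower: "ennreal T \<le> (\<Sum>k\<in>B. modular (x k) s)"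
    and upper: "(\<Sum>k\<in>B. modular (x k) s') \<le> ennreal T'"
  shows "T \<le> C * T' + real (card B) * D / real n"
proof -
  have "ennreal T \<le> (\<Sum>k\<in>B. ennreal C * modular (x k) s' + ennreal D * ennreal (1 / real n))"
    using lower
  proof (rule order_trans, intro sum_mono)
    fix k assume k: "k \<in> B"
    have "modular (x k) s \<le> ennreal C * modular (x k) s' + ennreal D * emeasure unit_leb (supp (x k))"
      using x[OF k] s CD le by (rule modular_compare)
    also have "\<dots> \<le> ennreal C * modular (x k) s' + ennreal D * ennreal (1 / real n)"
      using small[OF k] by (intro add_left_mono mult_left_mono) auto
    finally show "modular (x k) s \<le> \<dots>" .
  qed
  also have "\<dots> = ennreal C * (\<Sum>k\<in>B. modular (x k) s') + of_nat (card B) * (ennreal D * ennreal (1 / real n))"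
    by (simp add: sum.distrib sum_distrib_left)
  also have "\<dots> \<le> ennreal C * ennreal T' + ennreal (real (card B)) * (ennreal D * ennreal (1 / real n))"
    using upper by (intro add_mono mult_left_mono) (auto simp: ennreal_of_nat_eq_real_of_nat)
  also have "\<dots> = ennreal (C * T' + real (card B) * D / real n)"
    using CD T by (simp add: ennreal_mult[symmetric] ennreal_plus[symmetric] del: ennreal_plus)
  finally show ?thesis
    using CD T by (subst (asm) ennreal_le_iff) auto
qed

lemma le_if_le_add_over_n:
  fixes T C D :: real
  assumes "\<And>n. m \<le> n \<Longrightarrow> T \<le> C + D / real n"
  shows "T \<le> C"
proof (rule LIMSEQ_le_const)
  show "(\<lambda>n. C + D / real n) \<longlonglongrightarrow> C"
    using tendsto_add[OF tendsto_const[of C] lim_const_over_n[of D]] by simp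
  show "\<exists>m. \<forall>n\<ge>m. T \<le> C + D / real n" using assms by blast
qed

lemma powr_unbounded:
  fixes K e :: real
  assumes "0 < e"
  obtains m0 where "1 \<le> m0" "\<And>m. m0 \<le> m \<Longrightarrow> K < real m powr e"
proof -
  obtain m0 :: nat where m0: "(max K 0 + 1) powr (1 / e) < real m0"
    using reals_Archimedean2 by blast
  show ?thesis
  proof (rule that[of "max 1 m0"])
    fix m assume "max 1 m0 \<le> m"
    then have "(max K 0 + 1) powr (1 / e) \<le> real m" using m0 by linarith
    then have "((max K 0 + 1) powr (1 / e)) powr e \<le> real m powr e"
      using assms by (intro powr_mono2) auto
    then show "K < real m powr e" using assms by (simp add: powr_powr)
  qed simp
qed

text \<open>
  Write \<open>r = 1 / p\<close> and suppose \<open>\<beta>\<^sub>N < 1 / q < r\<close>. The sum of \<open>m\<close> of the functions has norm about \<open>m\<^sup>r\<close>,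
  so dividing by \<open>m\<^sup>r\<close> must bring its modular from about \<open>m\<close> down to about \<open>1\<close> and not further. But growth
  with exponent at least \<open>q\<close> reduces it to a multiple of \<open>m\<^bsup>1 - qr\<^esup>\<close>, which tends to \<open>0\<close>.
\<close>

lemma inverse_le_beta_if_represented:
  assumes rep: "sym_finitely_represented p (orlicz_space N) (luxemburg_norm N)" and p: "1 \<le> p"
    and beta: "0 < orlicz_beta N"
  shows "1 / real_of_ereal p \<le> orlicz_beta N"
proof (rule ccontr)
  define r where "r = 1 / real_of_ereal p"
  assume "\<not> 1 / real_of_ereal p \<le> orlicz_beta N"
  then obtain y where y: "orlicz_beta N < y" "y < r"
    using dense by (auto simp: r_def not_le)
  define q where "q = 1 / y"
  have q: "0 < q" "orlicz_beta N < 1 / q" "1 < q * r"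
    using y beta by (auto simp: q_def field_simps)
  have r0: "0 < r" using y beta by linarith
  have "grows_at_least q" using q by (intro grows_at_least_if_beta_less) auto
  then obtain c V where c: "0 < c" and V: "0 < V"
    and grow: "\<And>w R. V \<le> w \<Longrightarrow> (1::real) \<le> R \<Longrightarrow> c * R powr q * N w \<le> N (R * w)"
    by (auto simp: grows_at_least_def)
  obtain m1 where m1: "1 \<le> m1" "\<And>m. m1 \<le> m \<Longrightarrow> 9 < real m powr r"
    using powr_unbounded[OF r0] by blast
  obtain m2 where m2: "1 \<le> m2" "\<And>m. m2 \<le> m \<Longrightarrow> 9 powr q / c < real m powr (q * r - 1)"
    using powr_unbounded[of "q * r - 1"] q by auto
  define m where "m = max m1 m2"
  have m: "1 \<le> m" "9 < real m powr r" "9 powr q / c < real m powr (q * r - 1)"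
    using m1 m2 by (auto simp: m_def)
  \<comment> \<open>the two factors \<open>3\<close> that separate the lower from the upper bound on the modular\<close>
  define s where "s = 9 / real m powr r"
  have s: "0 < s" "s \<le> 1" using m by (auto simp: s_def)
  have le: "N (s * v) \<le> s powr q / c * N v + N V" if v: "0 < v" for v
  proof (cases "V \<le> s * v")
    case True
    have "c * (1 / s) powr q * N (s * v) \<le> N (1 / s * (s * v))"
      using True s by (intro grow) auto
    then have "N (s * v) \<le> s powr q / c * N v"
      using s c by (simp add: powr_divide field_simps)
    then show ?thesis using V N_nonneg[of V] by linarith
  next
    case False
    then have "N (s * v) \<le> N V" using s v by (intro N_le) auto
    moreover have "0 \<le> s powr q / c * N v" using c v by simp
    ultimately show ?thesis by linarith
  qed
  have "1 \<le> s powr q / c * real m + real m * N V / real n" if "m \<le> n" for n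
  proof -
    have n: "1 \<le> n" using that m by simp
    obtain x where x: "\<And>k. k \<in> {1..n} \<Longrightarrow> x k \<in> borel_measurable unit_leb"
      "\<And>k. k \<in> {1..n} \<Longrightarrow> emeasure unit_leb (supp (x k)) \<le> ennreal (1 / real n)"
      and up: "\<And>B. B \<subseteq> {1..n} \<Longrightarrow> B \<noteq> {} \<Longrightarrow> (\<Sum>k\<in>B. modular (x k) (1 / (3 * real (card B) powr r))) \<le> 1"
      and low: "\<And>B. B \<subseteq> {1..n} \<Longrightarrow> B \<noteq> {} \<Longrightarrow> 1 \<le> (\<Sum>k\<in>B. modular (x k) (3 / real (card B) powr r))"
      using sym_finitely_represented_modular[OF rep p n] unfolding r_def by metis
    have "(\<Sum>k\<in>{1..m}. modular (x k) (1 / 3)) \<le> (\<Sum>k\<in>{1..m}. 1)"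
      using up[of "{_}"] that by (intro sum_mono) auto
    then have upper: "(\<Sum>k\<in>{1..m}. modular (x k) (1 / 3)) \<le> ennreal (real m)"
      by (simp add: ennreal_of_nat_eq_real_of_nat)
    have lower: "ennreal 1 \<le> (\<Sum>k\<in>{1..m}. modular (x k) (s * (1 / 3)))"
      using low[of "{1..m}"] that m by (simp add: s_def)
    have "1 \<le> s powr q / c * real m + real (card {1..m}) * N V / real n"
    proof (rule modular_sum_compare[OF n _ x _ _ _ _ _ _ lower upper])
      fix v :: real assume "0 < v"
      then show "N (s * (1 / 3) * v) \<le> s powr q / c * N (1 / 3 * v) + N V"
        using le[of "1 / 3 * v"] by (simp add: mult.assoc)
    qed (use that s c V in auto)
    then show ?thesis by simp
  qed
  then have "1 \<le> s powr q / c * real m"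
    by (rule le_if_le_add_over_n)
  also have "s powr q = 9 powr q / real m powr (q * r)"
    using m by (simp add: s_def powr_divide powr_powr mult.commute)
  finally have "real m powr (q * r) \<le> 9 powr q / c * real m powr 1"
    using m c by (simp add: field_simps)
  then have "real m powr (q * r) / real m powr 1 \<le> 9 powr q / c"
    using m by (simp add: field_simps)
  then show False using m by (simp add: powr_diff)
qed

text \<open>
  The same comparison in the other direction: if \<open>r < 1 / q < \<alpha>\<^sub>N\<close>, then growth with exponent at most \<open>q\<close>
  bounds the modular \<open>m\<close> by a multiple of \<open>m\<^bsup>qr\<^esup>\<close>, although \<open>q r < 1\<close>. For \<open>p = \<infinity>\<close> this is the case
  \<open>r = 0\<close>.
\<close>

lemma alpha_le_inverse_if_represented:
  assumes rep: "sym_finitely_represented p (orlicz_space N) (luxemburg_norm N)" and p: "1 \<le> p"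
  shows "orlicz_alpha N \<le> 1 / real_of_ereal p"
proof (rule ccontr)
  define r where "r = 1 / real_of_ereal p"
  have r0: "0 \<le> r" using p by (cases p) (auto simp: r_def)
  assume "\<not> orlicz_alpha N \<le> 1 / real_of_ereal p"
  then obtain y where y: "r < y" "y < orlicz_alpha N"
    using dense by (auto simp: r_def not_le)
  define q where "q = 1 / y"
  have q: "0 < q" "1 / q < orlicz_alpha N" "q * r < 1"
    using y r0 by (auto simp: q_def field_simps)
  have "grows_at_most q" using q by (intro grows_at_most_if_less_alpha) auto
  then obtain C V where C: "0 < C" and V: "0 < V"
    and grow: "\<And>w R. V \<le> w \<Longrightarrow> (1::real) \<le> R \<Longrightarrow> N (R * w) \<le> C * R powr q * N w"
    by (auto simp: grows_at_most_def)
  obtain m where m: "1 \<le> m" "C * 9 powr q < real m powr (1 - q * r)"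
    using powr_unbounded[of "1 - q * r"] q by (metis diff_gt_0_iff_gt order_refl)
  \<comment> \<open>the ratio of the dilations \<open>3\<close> and \<open>1 / (3 m\<^sup>r)\<close>\<close>
  define R where "R = 9 * real m powr r"
  have "real m powr 0 \<le> real m powr r" using m r0 by (intro powr_mono) auto
  then have R: "1 \<le> R" using m by (simp add: R_def)
  have le: "N v \<le> C * R powr q * N (v / R) + N (V * R)" if v: "0 < v" for v
  proof (cases "V \<le> v / R")
    case True
    have "N v \<le> C * R powr q * N (v / R)"
      using grow[OF True R] R by simp
    moreover have "0 \<le> N (V * R)" using V R by simp
    ultimately show ?thesis by linarith
  next
    case False
    then have "N v \<le> N (V * R)" using R v by (intro N_le) (auto simp: field_simps)
    moreover have "0 \<le> C * R powr q * N (v / R)" using C v R by simp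
    ultimately show ?thesis by linarith
  qed
  have "real m \<le> C * R powr q + real m * N (V * R) / real n" if "m \<le> n" for n
  proof -
    have n: "1 \<le> n" using that m by simp
    obtain x where x: "\<And>k. k \<in> {1..n} \<Longrightarrow> x k \<in> borel_measurable unit_leb"
      "\<And>k. k \<in> {1..n} \<Longrightarrow> emeasure unit_leb (supp (x k)) \<le> ennreal (1 / real n)"
      and up: "\<And>B. B \<subseteq> {1..n} \<Longrightarrow> B \<noteq> {} \<Longrightarrow> (\<Sum>k\<in>B. modular (x k) (1 / (3 * real (card B) powr r))) \<le> 1"
      and low: "\<And>B. B \<subseteq> {1..n} \<Longrightarrow> B \<noteq> {} \<Longrightarrow> 1 \<le> (\<Sum>k\<in>B. modular (x k) (3 / real (card B) powr r))"
      using sym_finitely_represented_modular[OF rep p n] unfolding r_def by metis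
    have "(\<Sum>k\<in>{1..m}. 1) \<le> (\<Sum>k\<in>{1..m}. modular (x k) 3)"
      using low[of "{_}"] that by (intro sum_mono) auto
    then have lower: "ennreal (real m) \<le> (\<Sum>k\<in>{1..m}. modular (x k) 3)"
      by (simp add: ennreal_of_nat_eq_real_of_nat)
    have upper: "(\<Sum>k\<in>{1..m}. modular (x k) (3 / R)) \<le> ennreal 1"
      using up[of "{1..m}"] that m by (simp add: R_def)
    have "real m \<le> C * R powr q * 1 + real (card {1..m}) * N (V * R) / real n"
    proof (rule modular_sum_compare[OF n _ x _ _ _ _ _ _ lower upper])
      fix v :: real assume "0 < v"
      then show "N (3 * v) \<le> C * R powr q * N (3 / R * v) + N (V * R)"
        using le[of "3 * v"] by simp
    qed (use that R C V in auto)
    then show ?thesis by simp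
  qed
  then have "real m \<le> C * R powr q"
    by (rule le_if_le_add_over_n)
  also have "R powr q = 9 powr q * real m powr (q * r)"
    by (simp add: R_def powr_mult powr_powr mult.commute)
  finally have "real m powr 1 / real m powr (q * r) \<le> C * 9 powr q"
    using m by (simp add: field_simps)
  then show False using m by (simp add: powr_diff)
qed

end

section \<open>The representation set\<close>

text \<open>
  In terms of \<open>1 / p\<close>, with value \<open>0\<close> at \<open>p = \<infinity>\<close>, the interval has the end points \<open>a\<close> and \<open>b\<close>, so
  that finite and infinite exponents obey the same two inequalities.
\<close>

lemma ereal_mem_inverse_interval_iff:
  assumes "0 < a" "0 < b" "1 \<le> p"
  shows "p \<in> {1 / ereal b .. 1 / ereal a} \<longleftrightarrow> a \<le> 1 / real_of_ereal p \<and> 1 / real_of_ereal p \<le> b"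
proof -
  have inv: "1 / ereal b = ereal (1 / b)" "1 / ereal a = ereal (1 / a)"
    using assms by (simp_all add: one_ereal_def)
  show ?thesis
  proof (cases p)
    case (real r)
    then have "0 < r" using assms(3) by (simp add: one_ereal_def)
    then show ?thesis
      unfolding inv real using assms by (auto simp: field_simps)
  qed (use assms inv in auto)
qed

theorem theorem8:
  fixes N :: "real \<Rightarrow> real"
  assumes "orlicz_function N"
    and "Delta2_infinity N"
  shows "sym_fin_rep_set (orlicz_space N) (luxemburg_norm N) =
         {1 / ereal (orlicz_beta N) .. 1 / ereal (orlicz_alpha N)}"
proof -
  interpret orlicz N using assms(1) by unfold_locales
  have alpha: "0 < orlicz_alpha N" using assms(2) by (rule alpha_pos)
  have beta: "0 < orlicz_beta N" using alpha alpha_le_beta by linarith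
  note interval = ereal_mem_inverse_interval_iff[OF alpha beta]
  show ?thesis
  proof (intro equalityI subsetI)
    fix p assume "p \<in> sym_fin_rep_set (orlicz_space N) (luxemburg_norm N)"
    then have p: "1 \<le> p" "sym_finitely_represented p (orlicz_space N) (luxemburg_norm N)"
      by (auto simp: sym_fin_rep_set_def)
    show "p \<in> {1 / ereal (orlicz_beta N) .. 1 / ereal (orlicz_alpha N)}"
      using interval[OF p(1)] alpha_le_inverse_if_represented[OF p(2,1)]
        inverse_le_beta_if_represented[OF p(2,1) beta] by simp
  next
    fix p assume p: "p \<in> {1 / ereal (orlicz_beta N) .. 1 / ereal (orlicz_alpha N)}"
    have "1 \<le> 1 / orlicz_beta N" using beta beta_le_1 by simp
    then have "1 \<le> 1 / ereal (orlicz_beta N)" using beta by (simp add: one_ereal_def)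
    then have p1: "1 \<le> p" using p by (auto intro: order_trans)
    have between: "orlicz_alpha N \<le> 1 / real_of_ereal p" "1 / real_of_ereal p \<le> orlicz_beta N"
      using interval[OF p1] p by auto
    obtain r where r: "p = ereal r" "1 \<le> r"
      using p1 between(1) alpha by (cases p) (auto simp: one_ereal_def)
    have "q \<le> r" if "grows_at_least q" for q
    proof (cases "0 < q")
      case True
      then have "1 / r \<le> 1 / q"
        using beta_le_if_grows_at_least[OF True that] between(2) r by simp
      then show ?thesis using True r by (simp add: field_simps)
    qed (use r in linarith)
    moreover have "r \<le> q" if "0 < q" "grows_at_most q" for q
    proof -
      have "1 / q \<le> 1 / r"
        using le_alpha_if_grows_at_most[OF that] between(1) r by simp
      then show ?thesis using that r by (simp add: field_simps)
    qed
    ultimately have "\<exists>(J :: nat set) w v. finite J \<and> (\<forall>j\<in>J. 0 < w j \<and> 0 < v j) \<and> sum w J \<le> \<kappa> \<and>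
        (\<forall>s. 0 \<le> s \<longrightarrow> s \<le> 1 \<longrightarrow> \<bar>(\<Sum>j\<in>J. w j * N (s * v j)) - s powr r\<bar> \<le> \<delta>)"
      if "0 < \<delta>" "0 < \<kappa>" for \<delta> \<kappa>
      using power_approximation[of r \<delta> \<kappa>] that r by (smt (verit))
    then have "sym_finitely_represented (ereal r) (orlicz_space N) (luxemburg_norm N)"
      using r by (intro sym_finitely_represented_if_approximable) auto
    then show "p \<in> sym_fin_rep_set (orlicz_space N) (luxemburg_norm N)"
      using p1 r by (simp add: sym_fin_rep_set_def)
  qed
qed

end
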